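(* Let $n\in\mathbb{N}$, $n\geq 1$. There exists a constant $C\in(0,\infty)$, depending only on $n$, such that for all nonnegative Lebesgue measurable functions $f_1,\ldots,f_{2n}$ on $\mathbb{R}^{2n}$, $$\int_{\mathbb{R}^{2n+1}}\prod_{j=1}^{2n}f_j(\pi_j(p))\,dp\leq C\prod_{j=1}^{2n}\|f_j\|_{\frac{n(2n+1)}{n+1}}.$$
   Context: Points of $\mathbb{R}^{2n+1}$ (the underlying space of the $n$-th Heisenberg group $\mathbb{H}^n$) are written $(x,t)$ with $x=(x_1,\ldots,x_{2n})\in\mathbb{R}^{2n}$ and $t\in\mathbb{R}$. For $x\in\mathbb{R}^{2n}$, $\hat x_j\in\mathbb{R}^{2n-1}$ denotes the point obtained by deleting the $j$-th coordinate of $x$. The vertical coordinate projections $\pi_1,\ldots,\pi_{2n}:\mathbb{R}^{2n+1}\to\mathbb{R}^{2n}$ are $$\pi_j(x,t)=\big(\hat x_j,\,t+\tfrac12 x_jx_{n+j}\big),\qquad \pi_{n+j}(x,t)=\big(\hat x_{n+j},\,t-\tfrac12 x_jx_{n+j}\big),\qquad j=1,\ldots,n.$$ $\|f\|_p=\left(\int_{\mathbb{R}^{2n}} |f|^p\right)^{1/p}\in[0,\infty]$ is the $L^p$ norm with respect to Lebesgue measure on $\mathbb{R}^{2n}$; all integrals are with respect to Lebesgue measure. Convention: $0\cdot\infty=0$. *)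

theory Defs
  imports "HOL-Analysis.Analysis"
begin

text \<open>
  A point of \<open>\<real>\<^sup>d\<close> is a function in \<^term>\<open>{1..d} \<rightarrow>\<^sub>E (UNIV :: real set)\<close>, that is, a real vector with
  coordinates \<open>1, \<dots>, d\<close> (and \<^const>\<open>undefined\<close> elsewhere), so that \<open>d\<close> may be any natural number
  expression.  The measure below is the completion of the \<open>d\<close>-fold product of one-dimensional
  Lebesgue measure; its measurable sets are the Lebesgue (not only the Borel) sets.
\<close>

definition lebesgue_Rn :: "nat \<Rightarrow> (nat \<Rightarrow> real) measure" where
  "lebesgue_Rn d = completion (PiM {1..d} (\<lambda>_. lborel))"

definition delete_coord :: "nat \<Rightarrow> nat \<Rightarrow> (nat \<Rightarrow> real) \<Rightarrow> (nat \<Rightarrow> real)" where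
  "delete_coord d j x = (\<lambda>i\<in>{1..d - 1}. if i < j then x i else x (i + 1))"

text \<open>
  A point \<open>(x, t)\<close> with \<open>x \<in> \<real>\<^sup>d\<close> and \<open>t \<in> \<real>\<close> is the vector of \<open>\<real>\<^sup>d\<^sup>+\<^sup>1\<close> whose last coordinate is \<open>t\<close>.
\<close>

definition append_coord :: "nat \<Rightarrow> (nat \<Rightarrow> real) \<Rightarrow> real \<Rightarrow> (nat \<Rightarrow> real)" where
  "append_coord d x t = (\<lambda>i\<in>{1..d + 1}. if i \<le> d then x i else t)"

text \<open>
  In \<open>vert_proj n k p\<close> the coordinates of \<open>p = (x, t)\<close> are \<open>x\<^sub>i = p i\<close> for \<open>1 \<le> i \<le> 2n\<close> and
  \<open>t = p (2n + 1)\<close>.  In the second branch \<open>k = n + j\<close> with \<open>1 \<le> j \<le> n\<close>.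
\<close>

definition vert_proj :: "nat \<Rightarrow> nat \<Rightarrow> (nat \<Rightarrow> real) \<Rightarrow> (nat \<Rightarrow> real)" where
  "vert_proj n k p =
     append_coord (2 * n - 1) (delete_coord (2 * n) k p)
       (if k \<le> n then p (2 * n + 1) + 1 / 2 * p k * p (n + k)
        else p (2 * n + 1) - 1 / 2 * p (k - n) * p k)"

text \<open>Intended for exponents \<open>a > 0\<close>, where \<open>\<infinity>\<^sup>a = \<infinity>\<close> and \<open>0\<^sup>a = 0\<close>.\<close>

definition ennreal_powr :: "ennreal \<Rightarrow> real \<Rightarrow> ennreal" where
  "ennreal_powr x a = (if x = \<infinity> then \<infinity> else ennreal (enn2real x powr a))"

definition Lp_norm :: "real \<Rightarrow> 'a measure \<Rightarrow> ('a \<Rightarrow> ennreal) \<Rightarrow> ennreal" where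
  "Lp_norm p M f = ennreal_powr (\<integral>\<^sup>+ x. ennreal_powr (f x) p \<partial>M) (1 / p)"

end

theory Submission
  imports Defs
begin

text \<open>
  For \<open>n = 1\<close> the inequality is dual to the \<open>L\<^sup>3\<^sup>/\<^sup>2 \<rightarrow> L\<^sup>3\<close> bound for the planar Radon transform, which follows
  from the one-dimensional reverse Hardy--Littlewood--Sobolev inequality
  \<open>(\<integral>h\<^sup>2\<^sup>/\<^sup>3)\<^sup>3 \<le> 8 \<integral>\<integral> h(x) h(y) |x - y|\<close> used on every line.

  For \<open>n \<ge> 2\<close> put \<open>F\<^sub>j = f\<^sub>j\<^sup>p\<close> and let \<open>\<phi>\<^sub>j\<close>, a function of the \<open>2n - 2\<close> variables other than \<open>x\<^sub>j\<close>, its partner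
  and \<open>t\<close>, be the integral of \<open>F\<^sub>j\<close> over the partner variable and \<open>t\<close>.  Two mixed-norm estimates hold.  Hoelder's
  inequality over the \<open>n\<close> conjugate pairs, the case \<open>n = 1\<close> on the fibres of each pair, and Cauchy--Schwarz bound
  \<open>\<integral>\<Prod> F\<^sub>j powr (2/(3n)) \<phi>\<^sub>j powr (-1/(6n))\<close>.  Hoelder's inequality in \<open>t\<close> followed by inequalities of Loomis--Whitney
  type in the remaining variables bounds \<open>\<integral>\<Prod> F\<^sub>j powr (1/(2n)) \<phi>\<^sub>j powr (1/(2n(2n-2)))\<close>.  In the geometric mean of the
  two integrands with weights \<open>3/(2n+1)\<close> and \<open>(2n-2)/(2n+1)\<close> the powers of \<open>\<phi>\<^sub>j\<close> cancel and \<open>F\<^sub>j\<close> is left with the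
  power \<open>1/p\<close>.  As all kernels are positive, Hoelder's inequality thus replaces multilinear interpolation.
\<close>

section \<open>Hoelder's inequality for extended nonnegative functions\<close>

notation ennreal_powr (infixr "powre" 80)

lemma ennreal_powr_top [simp]: "\<infinity> powre a = \<infinity>" "top powre a = top"
  by (auto simp: ennreal_powr_def)

lemma ennreal_powr_ennreal: "x \<ge> 0 \<Longrightarrow> ennreal x powre a = ennreal (x powr a)"
  by (simp add: ennreal_powr_def)

lemma ennreal_powr_0 [simp]: "0 powre a = 0"
  by (simp add: ennreal_powr_def)

lemma ennreal_powr_1 [simp]: "1 powre a = 1"
  by (simp add: ennreal_powr_def)

lemma ennreal_powr_one_right [simp]: "x powre 1 = x"
  by (cases x) (auto simp: ennreal_powr_ennreal)

lemma ennreal_powr_eq_0_iff [simp]: "x powre a = 0 \<longleftrightarrow> x = 0"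
  by (cases x) (auto simp: ennreal_powr_ennreal)

lemma ennreal_powr_eq_top_iff [simp]: "x powre a = top \<longleftrightarrow> x = top"
  by (cases x) (auto simp: ennreal_powr_ennreal)

lemma ennreal_powr_mono: "a \<ge> 0 \<Longrightarrow> x \<le> y \<Longrightarrow> x powre a \<le> y powre a"
  by (cases x; cases y) (auto simp: ennreal_powr_ennreal powr_mono2 top_unique)

text \<open>The values 0 and \<infinity> are fixed by every exponent, negative ones included, so the
  identity is compatible with 0 * \<infinity> = 0. For finite nonzero arguments it is the real
  law.\<close>

lemma ennreal_powr_mult: "(x * y) powre a = x powre a * y powre a"
proof (cases "x = 0 \<or> y = 0 \<or> x = top \<or> y = top")
  case True
  then show ?thesis by (auto simp: ennreal_mult_eq_top_iff ennreal_mult_top ennreal_top_mult)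
next
  case False
  then obtain r s where "x = ennreal r" "y = ennreal s" "r \<ge> 0" "s \<ge> 0"
    by (cases x; cases y) auto
  then show ?thesis
    by (simp add: ennreal_powr_ennreal powr_mult flip: ennreal_mult)
qed

lemma ennreal_powr_prod: "(\<Prod>i\<in>I. f i) powre a = (\<Prod>i\<in>I. f i powre a)"
  by (induction I rule: infinite_finite_induct) (auto simp: ennreal_powr_mult)

lemma ennreal_powr_powr: "(x powre a) powre b = x powre (a * b)"
  by (cases x) (auto simp: ennreal_powr_ennreal powr_powr)

lemma ennreal_powr_add:
  assumes "a \<ge> 0 \<and> b \<ge> 0 \<or> x \<noteq> 0 \<and> x \<noteq> top"
  shows "x powre (a + b) = x powre a * x powre b"
  using assms
  by (cases x) (auto simp: ennreal_powr_ennreal powr_add ennreal_mult)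

lemma ennreal_powr_of_nat:
  assumes "n > 0"
  shows "x powre real n = x ^ n"
  using assms by (cases x) (auto simp: ennreal_powr_ennreal powr_realpow' ennreal_power top_power_ennreal)

lemma ennreal_powr_numeral: "x powre numeral k = x ^ numeral k"
  using ennreal_powr_of_nat[of "numeral k" x] by simp

lemma measurable_ennreal_powr [measurable]:
  "f \<in> borel_measurable M \<Longrightarrow> (\<lambda>x. f x powre a) \<in> borel_measurable M"
proof -
  assume [measurable]: "f \<in> borel_measurable M"
  have [measurable]: "{x \<in> space M. f x = \<infinity>} \<in> sets M"
    using measurable_sets[OF \<open>f \<in> borel_measurable M\<close>, of "{\<infinity>}"]
    by (simp add: vimage_def Int_def conj_commute)
  have "(\<lambda>x. enn2real (f x) powr a) \<in> borel_measurable M"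
    by measurable
  then show ?thesis
    unfolding ennreal_powr_def by (intro measurable_If) auto
qed

text \<open>After division by the weighted sum \<open>S\<close>, the bound ln y \<le> y - 1 at y =
  \<open>x i / S\<close> is summed with the weights; the linear terms cancel because the weights add
  up to 1. A vanishing \<open>x i\<close> is split off since ln is of no use there.\<close>

lemma weighted_arith_geom_mean:
  fixes x w :: "'i \<Rightarrow> real"
  assumes "finite I" "\<And>i. i \<in> I \<Longrightarrow> w i > 0" "sum w I = 1" "\<And>i. i \<in> I \<Longrightarrow> x i \<ge> 0"
  shows "(\<Prod>i\<in>I. x i powr w i) \<le> (\<Sum>i\<in>I. w i * x i)"
proof (cases "\<exists>i\<in>I. x i = 0")
  case True
  then have "(\<Prod>i\<in>I. x i powr w i) = 0" using assms(1) by auto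
  moreover have "(\<Sum>i\<in>I. w i * x i) \<ge> 0"
    using assms by (intro sum_nonneg mult_nonneg_nonneg) (auto simp: less_imp_le)
  ultimately show ?thesis by simp
next
  case False
  with assms have pos: "x i > 0" if "i \<in> I" for i using that by force
  define S where "S = (\<Sum>i\<in>I. w i * x i)"
  have "I \<noteq> {}" using assms(3) by auto
  then have S: "S > 0" unfolding S_def using assms pos by (intro sum_pos) auto
  have "(\<Sum>i\<in>I. w i * ln (x i)) - ln S = (\<Sum>i\<in>I. w i * (ln (x i) - ln S))"
    using assms(3) by (simp add: right_diff_distrib sum_subtractf flip: sum_distrib_right)
  also have "\<dots> = (\<Sum>i\<in>I. w i * ln (x i / S))"
    using pos S by (intro sum.cong) (auto simp: ln_div dest!: pos)
  also have "\<dots> \<le> (\<Sum>i\<in>I. w i * (x i / S - 1))"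
    using pos S assms(2) by (intro sum_mono mult_left_mono ln_le_minus_one) (auto simp: less_imp_le)
  also have "\<dots> = S / S - 1"
    using assms(3) by (simp add: S_def right_diff_distrib sum_subtractf flip: sum_divide_distrib)
  finally have *: "(\<Sum>i\<in>I. w i * ln (x i)) \<le> ln S" using S by simp
  have "(\<Prod>i\<in>I. x i powr w i) = exp (\<Sum>i\<in>I. w i * ln (x i))"
    using pos assms(1) by (auto simp: exp_sum powr_def intro!: prod.cong dest!: pos)
  also have "\<dots> \<le> exp (ln S)" using * by simp
  finally show ?thesis using S by (simp add: S_def)
qed

text \<open>Each function is divided by its integral, the weighted arithmetic-geometric mean
  inequality is applied pointwise, and the resulting sum integrates to the sum of the weights, which
  is 1.\<close>

lemma nn_integral_Holder_prod:
  fixes f :: "'i \<Rightarrow> 'a \<Rightarrow> ennreal"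
  assumes I: "finite I" and w: "\<And>i. i \<in> I \<Longrightarrow> w i > 0" "sum w I = 1"
    and [measurable]: "\<And>i. i \<in> I \<Longrightarrow> f i \<in> borel_measurable M"
  shows "(\<integral>\<^sup>+x. (\<Prod>i\<in>I. f i x powre w i) \<partial>M) \<le> (\<Prod>i\<in>I. (\<integral>\<^sup>+x. f i x \<partial>M) powre w i)"
proof -
  define m where "m i = (\<integral>\<^sup>+x. f i x \<partial>M)" for i
  \<comment> \<open>A zero integral is treated before an infinite one: with 0 * \<infinity> = 0 the
    right-hand side then vanishes, and so does the integrand almost everywhere.\<close>
  consider (zero) i where "i \<in> I" "m i = 0" | (top) i where "i \<in> I" "m i = top" "\<And>k. k \<in> I \<Longrightarrow> m k \<noteq> 0"
    | (fin) "\<And>k. k \<in> I \<Longrightarrow> m k \<noteq> 0 \<and> m k \<noteq> top" by blast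
  then show ?thesis
  proof cases
    case zero
    then have "AE x in M. f i x = 0" by (simp add: m_def nn_integral_0_iff_AE)
    then have "AE x in M. (\<Prod>i\<in>I. f i x powre w i) = 0"
      by eventually_elim (use zero I in auto)
    then have "(\<integral>\<^sup>+x. (\<Prod>i\<in>I. f i x powre w i) \<partial>M) = (\<integral>\<^sup>+x. 0 \<partial>M)"
      by (rule nn_integral_cong_AE)
    then show ?thesis by simp
  next
    case top
    then have "(\<Prod>i\<in>I. m i powre w i) = top"
      using I by (subst ennreal_prod_eq_top) auto
    then show ?thesis by (simp add: m_def)
  next
    case fin
    define r where "r i = enn2real (m i)" for i
    have r: "m i = ennreal (r i)" "r i > 0" if "i \<in> I" for i
      using fin[OF that] by (cases "m i"; simp add: r_def)+
    define C where "C = (\<Prod>i\<in>I. m i powre w i)"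
    have C: "C = ennreal (\<Prod>i\<in>I. r i powr w i)"
      unfolding C_def using r by (subst prod_ennreal[symmetric]) (auto intro!: prod.cong simp: ennreal_powr_ennreal less_imp_le)
    have AM: "(\<Prod>i\<in>I. y i powre w i) \<le> (\<Sum>i\<in>I. ennreal (w i) * y i)" for y :: "'i \<Rightarrow> ennreal"
    proof (cases "\<exists>i\<in>I. y i = top")
      case True
      then obtain i where i: "i \<in> I" "y i = top" by blast
      then have "ennreal (w i) * y i \<le> (\<Sum>i\<in>I. ennreal (w i) * y i)"
        using I by (intro member_le_sum) auto
      then have "(\<Sum>i\<in>I. ennreal (w i) * y i) = top"
        using i w(1)[of i] by (simp add: ennreal_mult_top top_unique)
      then show ?thesis by simp
    next
      case False
      then have y: "y i = ennreal (enn2real (y i))" if "i \<in> I" for i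
        using that by (simp add: less_top)
      have "(\<Prod>i\<in>I. y i powre w i) = ennreal (\<Prod>i\<in>I. enn2real (y i) powr w i)"
        by (subst prod_ennreal[symmetric]) (auto intro!: prod.cong simp: y ennreal_powr_ennreal[symmetric] simp flip: y)
      also have "\<dots> \<le> ennreal (\<Sum>i\<in>I. w i * enn2real (y i))"
        using I w by (intro ennreal_leI weighted_arith_geom_mean) auto
      also have "\<dots> = (\<Sum>i\<in>I. ennreal (w i) * y i)"
        using w by (subst sum_ennreal[symmetric])
          (auto intro!: sum.cong simp: less_imp_le ennreal_mult y[symmetric])
      finally show ?thesis .
    qed
    have "(\<integral>\<^sup>+x. (\<Prod>i\<in>I. f i x powre w i) \<partial>M) = (\<integral>\<^sup>+x. C * (\<Prod>i\<in>I. (ennreal (1 / r i) * f i x) powre w i) \<partial>M)"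
    proof (rule nn_integral_cong)
      fix x
      have "f i x = m i * (ennreal (1 / r i) * f i x)" if "i \<in> I" for i
        using r[OF that] by (simp add: mult.assoc[symmetric] ennreal_mult[symmetric])
      then have "(\<Prod>i\<in>I. f i x powre w i) = (\<Prod>i\<in>I. (m i * (ennreal (1 / r i) * f i x)) powre w i)"
        by (intro prod.cong) auto
      then show "(\<Prod>i\<in>I. f i x powre w i) = C * (\<Prod>i\<in>I. (ennreal (1 / r i) * f i x) powre w i)"
        by (simp add: ennreal_powr_mult prod.distrib C_def)
    qed
    also have "\<dots> = C * (\<integral>\<^sup>+x. (\<Prod>i\<in>I. (ennreal (1 / r i) * f i x) powre w i) \<partial>M)"
      by (rule nn_integral_cmult) measurable
    also have "\<dots> \<le> C * (\<integral>\<^sup>+x. (\<Sum>i\<in>I. ennreal (w i) * (ennreal (1 / r i) * f i x)) \<partial>M)"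
      by (intro mult_left_mono nn_integral_mono AM) simp
    also have "(\<integral>\<^sup>+x. (\<Sum>i\<in>I. ennreal (w i) * (ennreal (1 / r i) * f i x)) \<partial>M)
        = (\<Sum>i\<in>I. ennreal (w i) * (ennreal (1 / r i) * m i))"
      by (subst nn_integral_sum) (auto simp: nn_integral_cmult m_def)
    also have "\<dots> = (\<Sum>i\<in>I. ennreal (w i))"
      using r by (intro sum.cong refl) (simp add: ennreal_mult[symmetric] less_imp_le less_imp_neq[symmetric])
    also have "\<dots> = 1" using w by (simp add: sum_ennreal less_imp_le)
    finally show ?thesis by (simp add: C_def m_def)
  qed
qed

lemma nn_integral_Holder:
  assumes "a > 0" "b > 0" "a + b = 1"
    and [measurable]: "f \<in> borel_measurable M" "g \<in> borel_measurable M"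
  shows "(\<integral>\<^sup>+x. f x powre a * g x powre b \<partial>M) \<le> (\<integral>\<^sup>+x. f x \<partial>M) powre a * (\<integral>\<^sup>+x. g x \<partial>M) powre b"
  using nn_integral_Holder_prod[of UNIV "\<lambda>i. if i then a else b" "\<lambda>i. if i then f else g" M] assms
  by (simp add: UNIV_bool mult.commute add.commute)

section \<open>Monotone suprema and Borel majorants\<close>

lemma SUP_mult_incseq_ennreal:
  fixes a b :: "nat \<Rightarrow> ennreal"
  assumes "incseq a" "incseq b"
  shows "(SUP k. a k * b k) = (SUP k. a k) * (SUP k. b k)"
proof (rule antisym)
  show "(SUP k. a k * b k) \<le> (SUP k. a k) * (SUP k. b k)"
    by (intro SUP_least mult_mono SUP_upper) auto
  have "a i * b j \<le> (SUP k. a k * b k)" for i j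
  proof -
    have "a i * b j \<le> a (max i j) * b (max i j)"
      using assms by (intro mult_mono) (auto simp: incseq_def)
    also have "\<dots> \<le> (SUP k. a k * b k)" by (rule SUP_upper) simp
    finally show ?thesis .
  qed
  then show "(SUP k. a k) * (SUP k. b k) \<le> (SUP k. a k * b k)"
    by (simp add: SUP_mult_left_ennreal SUP_mult_right_ennreal SUP_least)
qed

lemma SUP_prod_incseq_ennreal:
  fixes a :: "'i \<Rightarrow> nat \<Rightarrow> ennreal"
  assumes "finite I" "\<And>i. i \<in> I \<Longrightarrow> incseq (a i)"
  shows "(SUP k. \<Prod>i\<in>I. a i k) = (\<Prod>i\<in>I. SUP k. a i k)"
  using assms
proof (induction I)
  case (insert i I)
  have "incseq (\<lambda>k. \<Prod>i\<in>I. a i k)"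
    using insert.prems by (auto simp: incseq_def intro!: prod_mono_ennreal)
  then show ?case using insert by (simp add: SUP_mult_incseq_ennreal)
qed simp

text \<open>This lets a function be recovered from its truncations by multiples of a nowhere
  vanishing weight: the multiples of \<open>y\<close> increase to \<infinity>, and the minimum with
  a fixed element distributes over suprema.\<close>

lemma ennreal_min_SUP_multiple:
  fixes x y :: ennreal
  assumes "y \<noteq> 0"
  shows "(SUP k. min x (of_nat k * y)) = x"
proof -
  have top: "(SUP k. of_nat k * y) = top"
    using assms by (simp add: SUP_mult_right_ennreal[symmetric] ennreal_SUP_of_nat_eq_top ennreal_top_mult)
  show ?thesis
    unfolding inf_min[symmetric] inf_SUP[symmetric] top by simp
qed

text \<open>A Borel version is raised to \<infinity> on a Borel null set that contains the
  exceptional points. The pointwise bound survives composition with a projection without following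
  null sets through preimages, while equality almost everywhere preserves norms.\<close>

lemma completion_borel_majorant:
  fixes f :: "'a \<Rightarrow> ennreal"
  assumes "f \<in> borel_measurable (completion M)"
  obtains g where "g \<in> borel_measurable M" "\<And>x. x \<in> space M \<Longrightarrow> f x \<le> g x" "AE x in M. f x = g x"
proof -
  obtain h where h [measurable]: "h \<in> borel_measurable M" and ae: "AE x in M. f x = h x"
    using completion_ex_borel_measurable[OF assms] by auto
  from AE_E[OF ae] obtain N where N: "{x \<in> space M. f x \<noteq> h x} \<subseteq> N" "emeasure M N = 0" "N \<in> sets M"
    by (metis (no_types, lifting) AE_E ae)
  have [measurable]: "N \<in> sets M" by (rule N)
  have "(\<lambda>x. if x \<in> N then top else h x) \<in> borel_measurable M" by measurable
  moreover have "f x \<le> (if x \<in> N then top else h x)" if "x \<in> space M" for x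
    using N that by auto
  moreover have "AE x in M. f x = (if x \<in> N then top else h x)"
  proof -
    have "AE x in M. x \<notin> N" using N by (intro AE_not_in) (auto simp: null_sets_def)
    with ae show ?thesis by eventually_elim simp
  qed
  ultimately show ?thesis by (rule that)
qed

section \<open>The planar Radon transform\<close>

text \<open>The antiderivative -1 / (1 + x) gives 1 on the half-line and reflection doubles it. The
  affine substitution centred at \<open>c\<close> contributes the factor 1/\<mu>.\<close>

lemma nn_integral_inverse_square_le:
  assumes "\<mu> > 0"
  shows "(\<integral>\<^sup>+y. ennreal (1 / (1 + \<mu> * \<bar>c - y\<bar>)\<^sup>2) \<partial>lborel) \<le> ennreal (2 / \<mu>)"
proof -
  have half: "(\<integral>\<^sup>+x. ennreal (1 / (1 + x)\<^sup>2) * indicator {0..} x \<partial>lborel) = 1"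
  proof -
    have "((\<lambda>x::real. - 1 / (1 + x)) \<longlongrightarrow> 0) at_top"
      by (intro tendsto_divide_0[OF tendsto_const] filterlim_at_top_imp_at_infinity
          filterlim_tendsto_add_at_top[OF tendsto_const] filterlim_ident)
    then have "(\<integral>\<^sup>+x. ennreal (1 / (1 + x)\<^sup>2) * indicator {0..} x \<partial>lborel) = ennreal (0 - (- 1 / (1 + 0)))"
      by (intro nn_integral_FTC_atLeast)
        (auto intro!: derivative_eq_intros simp: power2_eq_square add_nonneg_eq_0_iff)
    then show ?thesis by simp
  qed
  have "(\<integral>\<^sup>+x. ennreal (1 / (1 + \<bar>x::real\<bar>)\<^sup>2) \<partial>lborel)
      \<le> (\<integral>\<^sup>+x. ennreal (1 / (1 + x)\<^sup>2) * indicator {0..} x + ennreal (1 / (1 + (- x))\<^sup>2) * indicator {0..} (- x) \<partial>lborel)"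
    by (intro nn_integral_mono) (auto split: split_indicator)
  also have "\<dots> = 1 + (\<integral>\<^sup>+x. ennreal (1 / (1 + (- x))\<^sup>2) * indicator {0..} (- x :: real) \<partial>lborel)"
    by (subst nn_integral_add) (auto simp: half)
  also have "(\<integral>\<^sup>+x. ennreal (1 / (1 + (- x))\<^sup>2) * indicator {0..} (- x :: real) \<partial>lborel) = 1"
    using half by (subst (asm) nn_integral_real_affine[where c = "-1" and t = 0]) auto
  finally have two: "(\<integral>\<^sup>+x. ennreal (1 / (1 + \<bar>x::real\<bar>)\<^sup>2) \<partial>lborel) \<le> ennreal 2"
    by simp
  have "(\<integral>\<^sup>+y. ennreal (1 / (1 + \<mu> * \<bar>c - y\<bar>)\<^sup>2) \<partial>lborel)
      = ennreal (1 / \<mu>) * (\<integral>\<^sup>+x. ennreal (1 / (1 + \<bar>x\<bar>)\<^sup>2) \<partial>lborel)"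
    using assms by (subst nn_integral_real_affine[where c = "1 / \<mu>" and t = c])
      (auto simp: abs_mult)
  also have "\<dots> \<le> ennreal (1 / \<mu>) * ennreal 2"
    by (intro mult_left_mono two) simp
  also have "\<dots> = ennreal (2 / \<mu>)"
    using assms by (subst ennreal_mult[symmetric]) auto
  finally show ?thesis .
qed

text \<open>A Carlson-type inequality. Inserting the weight g(y) = 1 + \<mu>|c - y| and its inverse,
  Hoelder with exponents 3/2 and 3 bounds the left-hand side by 2(m + \<mu>v)^2/\<mu>, where m and v
  are the two integrals on the right; \<mu> = m/v yields 8mv.\<close>

lemma nn_integral_two_thirds_moment:
  fixes h :: "real \<Rightarrow> ennreal"
  assumes [measurable]: "h \<in> borel_measurable borel"
  shows "(\<integral>\<^sup>+y. h y powre (2/3) \<partial>lborel) ^ 3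
    \<le> 8 * (\<integral>\<^sup>+y. h y \<partial>lborel) * (\<integral>\<^sup>+y. h y * ennreal \<bar>c - y\<bar> \<partial>lborel)"
proof -
  define m v where "m = (\<integral>\<^sup>+y. h y \<partial>lborel)" and "v = (\<integral>\<^sup>+y. h y * ennreal \<bar>c - y\<bar> \<partial>lborel)"
  \<comment> \<open>If either integral is 0 then \<open>h\<close> vanishes almost everywhere,
    because |c - y| is zero only at y = c. Hence a product 0 * \<infinity> on the right occurs only
    when the left-hand side is 0.\<close>
  consider "AE y in lborel. h y = 0" | "m \<noteq> 0" "v \<noteq> 0" "m = top \<or> v = top" | "m \<noteq> 0" "v \<noteq> 0" "m \<noteq> top" "v \<noteq> top"
  proof (cases "m = 0 \<or> v = 0")
    case True
    then have "AE y in lborel. h y = 0"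
    proof
      assume "v = 0"
      then have "AE y in lborel. h y * ennreal \<bar>c - y\<bar> = 0"
        unfolding v_def by (subst (asm) nn_integral_0_iff_AE) auto
      with AE_lborel_singleton[of c] show ?thesis by eventually_elim auto
    qed (simp add: m_def nn_integral_0_iff_AE)
    then show ?thesis using that by blast
  qed (use that in blast)
  then show ?thesis
  proof cases
    case 1
    then have "AE y in lborel. h y powre (2/3) = 0" by eventually_elim simp
    then have "(\<integral>\<^sup>+y. h y powre (2/3) \<partial>lborel) = 0" by (subst nn_integral_0_iff_AE) auto
    then show ?thesis by simp
  next
    case 2
    then show ?thesis unfolding m_def[symmetric] v_def[symmetric]
      by (auto simp: ennreal_mult_top ennreal_top_mult)
  next
    case 3
    then obtain M V where M: "m = ennreal M" "M > 0" and V: "v = ennreal V" "V > 0"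
      by (cases m; cases v) (auto simp: less_le)
    define \<mu> where "\<mu> = M / V" \<comment> \<open>minimises \<open>(M + \<mu> V)\<^sup>2 / \<mu>\<close>\<close>
    have \<mu>: "\<mu> > 0" using M V by (simp add: \<mu>_def)
    define g where "g y = 1 + \<mu> * \<bar>c - y\<bar>" for y
    have g: "g y > 0" for y using \<mu> by (simp add: g_def add_pos_nonneg)
    have [measurable]: "g \<in> borel_measurable borel" unfolding g_def by measurable
    have "(\<integral>\<^sup>+y. h y powre (2/3) \<partial>lborel)
        = (\<integral>\<^sup>+y. (h y * ennreal (g y)) powre (2/3) * ennreal (1 / (g y)\<^sup>2) powre (1/3) \<partial>lborel)"
    proof (rule nn_integral_cong)
      fix y
      have "ennreal (g y) powre (2/3) * ennreal (1 / (g y)\<^sup>2) powre (1/3) = ennreal (g y powr (2/3) * (1 / g y ^ 2) powr (1/3))"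
        using g[of y] by (simp add: ennreal_powr_ennreal ennreal_mult)
      also have "(1 / g y ^ 2) powr (1/3) = g y powr (- (2/3))"
      proof -
        have "1 / g y ^ 2 = g y powr (- 2)" using g[of y] by (simp add: powr_minus_divide)
        then show ?thesis by (simp add: powr_powr)
      qed
      also have "g y powr (2/3) * g y powr (- (2/3)) = 1"
        using g[of y] by (simp flip: powr_add)
      finally show "h y powre (2/3) = (h y * ennreal (g y)) powre (2/3) * ennreal (1 / (g y)\<^sup>2) powre (1/3)"
        by (simp add: ennreal_powr_mult mult.assoc)
    qed
    also have "\<dots> \<le> (\<integral>\<^sup>+y. h y * ennreal (g y) \<partial>lborel) powre (2/3) * (\<integral>\<^sup>+y. ennreal (1 / (g y)\<^sup>2) \<partial>lborel) powre (1/3)"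
      by (rule nn_integral_Holder) auto
    also have "(\<integral>\<^sup>+y. h y * ennreal (g y) \<partial>lborel) = (\<integral>\<^sup>+y. h y + ennreal \<mu> * (h y * ennreal \<bar>c - y\<bar>) \<partial>lborel)"
      using \<mu> by (intro nn_integral_cong) (simp add: g_def ennreal_plus ennreal_mult algebra_simps)
    also have "\<dots> = m + ennreal \<mu> * v"
      by (subst nn_integral_add) (auto simp: nn_integral_cmult m_def v_def)
    also have "\<dots> = ennreal (2 * M)"
      using M V \<mu> by (simp add: \<mu>_def flip: ennreal_mult ennreal_plus)
    also have "ennreal (2 * M) powre (2/3) * (\<integral>\<^sup>+y. ennreal (1 / (g y)\<^sup>2) \<partial>lborel) powre (1/3)
        \<le> ennreal (2 * M) powre (2/3) * ennreal (2 / \<mu>) powre (1/3)"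
      unfolding g_def using \<mu> by (intro mult_left_mono ennreal_powr_mono nn_integral_inverse_square_le) auto
    finally have "(\<integral>\<^sup>+y. h y powre (2/3) \<partial>lborel) ^ 3 \<le> (ennreal (2 * M) powre (2/3) * ennreal (2 / \<mu>) powre (1/3)) ^ 3"
      by (rule power_mono) simp
    also have "\<dots> = ennreal (2 * M) powre 2 * ennreal (2 / \<mu>) powre 1"
      by (simp add: ennreal_powr_mult ennreal_powr_powr flip: ennreal_powr_numeral)
    also have "\<dots> = ennreal (8 * M * V)"
      using M V by (simp add: ennreal_powr_numeral ennreal_power \<mu>_def power2_eq_square flip: ennreal_mult)
    also have "\<dots> = 8 * m * v"
      using M V by (simp add: ennreal_mult)
    finally show ?thesis by (simp add: m_def v_def)
  qed
qed

text \<open>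
  A reverse Hardy--Littlewood--Sobolev inequality.  With \<open>m = \<integral>h\<close>, the left-hand side is at most
  \<open>8 m (\<integral>h(y)|x - y| dy)\<close> for every \<open>x\<close>; averaging over \<open>x\<close> with weight \<open>h(x)\<close> and cancelling \<open>m\<close>
  gives the claim, without any choice of a centre of mass.
\<close>

lemma reverse_HLS:
  fixes h :: "real \<Rightarrow> ennreal"
  assumes [measurable]: "h \<in> borel_measurable borel"
  shows "(\<integral>\<^sup>+y. h y powre (2/3) \<partial>lborel) ^ 3
    \<le> 8 * (\<integral>\<^sup>+x. \<integral>\<^sup>+y. h x * h y * ennreal \<bar>x - y\<bar> \<partial>lborel \<partial>lborel)"
proof -
  define m v where "m = (\<integral>\<^sup>+y. h y \<partial>lborel)" and "v x = (\<integral>\<^sup>+y. h y * ennreal \<bar>x - y\<bar> \<partial>lborel)" for x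
  have [measurable]: "v \<in> borel_measurable borel" unfolding v_def by measurable
  define A where "A = (\<integral>\<^sup>+x. h x * v x \<partial>lborel)"
  define L where "L = (\<integral>\<^sup>+y. h y powre (2/3) \<partial>lborel) ^ 3"
  have A: "(\<integral>\<^sup>+x. \<integral>\<^sup>+y. h x * h y * ennreal \<bar>x - y\<bar> \<partial>lborel \<partial>lborel) = A"
    unfolding A_def v_def by (intro nn_integral_cong) (simp add: nn_integral_cmult mult.assoc)
  have L: "L \<le> 8 * m * v x" for x
    unfolding L_def m_def v_def by (rule nn_integral_two_thirds_moment) simp
  consider "m = 0" | "m = top" | "m \<noteq> 0" "m \<noteq> top" by blast
  then have "L \<le> 8 * A"
  proof cases
    case 1
    then show ?thesis using L[of 0] by simp
  next
    case 2
    \<comment> \<open>Cancelling \<open>m\<close> is impossible here. By the triangle inequality |a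
      - b| m \<le> v(a) + v(b), so \<open>v\<close> is infinite at all points but at most one; a
      finite \<open>A\<close> would then force \<open>h\<close> to vanish almost everywhere, against
      m = \<infinity>.\<close>
    have "A = top"
    proof (rule ccontr)
      assume "A \<noteq> top"
      then have fin: "AE x in lborel. h x * v x \<noteq> \<infinity>"
        unfolding A_def by (intro nn_integral_PInf_AE) auto
      have "v a = top \<or> v b = top" if "a \<noteq> b" for a b
      proof -
        have "ennreal \<bar>a - b\<bar> * m = (\<integral>\<^sup>+y. ennreal \<bar>a - b\<bar> * h y \<partial>lborel)"
          by (simp add: m_def nn_integral_cmult)
        also have "\<dots> \<le> (\<integral>\<^sup>+y. h y * ennreal \<bar>a - y\<bar> + h y * ennreal \<bar>b - y\<bar> \<partial>lborel)"
          by (intro nn_integral_mono)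
            (auto simp: mult.commute distrib_left[symmetric] ennreal_plus[symmetric] simp del: ennreal_plus
              intro!: mult_left_mono ennreal_leI)
        also have "\<dots> = v a + v b"
          by (simp add: nn_integral_add v_def)
        finally show ?thesis using 2 that by (simp add: ennreal_mult_top top_unique)
      qed
      then obtain c where c: "\<And>x. x \<noteq> c \<Longrightarrow> v x = top" by metis
      have "AE x in lborel. h x = 0"
        using fin AE_lborel_singleton[of c] by eventually_elim (auto simp: c ennreal_mult_top split: if_splits)
      then have "m = 0" by (simp add: m_def nn_integral_0_iff_AE)
      with 2 show False by simp
    qed
    then show ?thesis by (simp add: ennreal_mult_top)
  next
    case 3
    have "m * L = (\<integral>\<^sup>+x. h x * L \<partial>lborel)"
      by (simp add: m_def nn_integral_multc)
    also have "\<dots> \<le> (\<integral>\<^sup>+x. h x * (8 * m * v x) \<partial>lborel)"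
      by (intro nn_integral_mono mult_left_mono L) simp
    also have "\<dots> = (\<integral>\<^sup>+x. (8 * m) * (h x * v x) \<partial>lborel)"
      by (simp add: ac_simps)
    also have "\<dots> = 8 * m * A"
      by (subst nn_integral_cmult) (auto simp: A_def)
    finally have "m * L \<le> m * (8 * A)" by (simp add: ac_simps)
    then show ?thesis using 3 by (simp add: ennreal_mult_le_mult_iff)
  qed
  then show ?thesis by (simp add: L_def A)
qed

lemma nn_integral_lborel_shift:
  fixes f :: "real \<Rightarrow> ennreal"
  assumes "f \<in> borel_measurable borel"
  shows "(\<integral>\<^sup>+x. f (x + c) \<partial>lborel) = (\<integral>\<^sup>+x. f x \<partial>lborel)"
  using nn_integral_real_affine[OF assms, of 1 c] by (simp add: add.commute)

text \<open>
  The endpoint bound \<open>L\<^sup>3\<^sup>/\<^sup>2 \<rightarrow> L\<^sup>3\<close> for the Radon transform in the plane.  The reverse inequality applied on each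
  line brings in exactly the Jacobian \<open>|x - x'|\<close> of the map from a line with two points on it to that pair of points.
\<close>

lemma planar_Radon:
  fixes G :: "real \<Rightarrow> real \<Rightarrow> ennreal"
  assumes [measurable]: "(\<lambda>(x, s). G x s) \<in> borel_measurable (borel \<Otimes>\<^sub>M borel)"
  shows "(\<integral>\<^sup>+y. \<integral>\<^sup>+s. (\<integral>\<^sup>+x. G x (s - x * y) powre (2/3) \<partial>lborel) ^ 3 \<partial>lborel \<partial>lborel)
    \<le> 8 * (\<integral>\<^sup>+x. \<integral>\<^sup>+s. G x s \<partial>lborel \<partial>lborel)\<^sup>2"
proof -
  define g where "g x = (\<integral>\<^sup>+s. G x s \<partial>lborel)" for x
  have [measurable]: "g \<in> borel_measurable borel" unfolding g_def by measurable
  \<comment> \<open>For fixed x \<noteq> x' a translation in s frees the first factor of y. The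
    substitution y \<mapsto> s + (x - x')y in the second factor then absorbs |x - x'| as its
    Jacobian. For x = x' the kernel is 0.\<close>
  have *: "(\<integral>\<^sup>+y. \<integral>\<^sup>+s. G x (s - x * y) * G x' (s - x' * y) * ennreal \<bar>x - x'\<bar> \<partial>lborel \<partial>lborel) \<le> g x * g x'" for x x'
  proof (cases "x = x'")
    case False
    have "(\<integral>\<^sup>+y. \<integral>\<^sup>+s. G x (s - x * y) * G x' (s - x' * y) * ennreal \<bar>x - x'\<bar> \<partial>lborel \<partial>lborel)
        = (\<integral>\<^sup>+y. \<integral>\<^sup>+s. G x s * G x' (s + (x - x') * y) * ennreal \<bar>x - x'\<bar> \<partial>lborel \<partial>lborel)"
    proof (rule nn_integral_cong)
      fix y
      show "(\<integral>\<^sup>+s. G x (s - x * y) * G x' (s - x' * y) * ennreal \<bar>x - x'\<bar> \<partial>lborel)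
        = (\<integral>\<^sup>+s. G x s * G x' (s + (x - x') * y) * ennreal \<bar>x - x'\<bar> \<partial>lborel)"
        by (subst nn_integral_lborel_shift[symmetric, where c = "x * y"]) (auto simp: algebra_simps)
    qed
    also have "\<dots> = (\<integral>\<^sup>+s. \<integral>\<^sup>+y. G x s * G x' (s + (x - x') * y) * ennreal \<bar>x - x'\<bar> \<partial>lborel \<partial>lborel)"
      by (rule lborel_pair.Fubini') measurable
    also have "\<dots> = (\<integral>\<^sup>+s. G x s * (ennreal \<bar>x - x'\<bar> * (\<integral>\<^sup>+y. G x' (s + (x - x') * y) \<partial>lborel)) \<partial>lborel)"
      by (intro nn_integral_cong, subst nn_integral_multc, measurable, subst nn_integral_cmult)
        (auto simp: ac_simps)
    also have "\<dots> = (\<integral>\<^sup>+s. G x s * g x' \<partial>lborel)"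
      unfolding g_def using False by (subst nn_integral_real_affine[where f = "G x'" and c = "x - x'", symmetric]) auto
    also have "\<dots> = g x * g x'"
      by (simp add: nn_integral_multc g_def)
    finally show ?thesis by simp
  qed simp
  have "(\<integral>\<^sup>+y. \<integral>\<^sup>+s. (\<integral>\<^sup>+x. G x (s - x * y) powre (2/3) \<partial>lborel) ^ 3 \<partial>lborel \<partial>lborel)
    \<le> (\<integral>\<^sup>+y. \<integral>\<^sup>+s. 8 * (\<integral>\<^sup>+x. \<integral>\<^sup>+x'. G x (s - x * y) * G x' (s - x' * y) * ennreal \<bar>x - x'\<bar> \<partial>lborel \<partial>lborel) \<partial>lborel \<partial>lborel)"
    by (intro nn_integral_mono reverse_HLS) measurable
  also have "\<dots> = 8 * (\<integral>\<^sup>+y. \<integral>\<^sup>+s. \<integral>\<^sup>+x. \<integral>\<^sup>+x'. G x (s - x * y) * G x' (s - x' * y) * ennreal \<bar>x - x'\<bar> \<partial>lborel \<partial>lborel \<partial>lborel \<partial>lborel)"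
    by (simp add: nn_integral_cmult)
  also have "(\<integral>\<^sup>+y. \<integral>\<^sup>+s. \<integral>\<^sup>+x. \<integral>\<^sup>+x'. G x (s - x * y) * G x' (s - x' * y) * ennreal \<bar>x - x'\<bar> \<partial>lborel \<partial>lborel \<partial>lborel \<partial>lborel)
     = (\<integral>\<^sup>+y. \<integral>\<^sup>+x. \<integral>\<^sup>+s. \<integral>\<^sup>+x'. G x (s - x * y) * G x' (s - x' * y) * ennreal \<bar>x - x'\<bar> \<partial>lborel \<partial>lborel \<partial>lborel \<partial>lborel)"
    by (intro nn_integral_cong lborel_pair.Fubini') measurable
  also have "\<dots> = (\<integral>\<^sup>+x. \<integral>\<^sup>+y. \<integral>\<^sup>+s. \<integral>\<^sup>+x'. G x (s - x * y) * G x' (s - x' * y) * ennreal \<bar>x - x'\<bar> \<partial>lborel \<partial>lborel \<partial>lborel \<partial>lborel)"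
    by (intro lborel_pair.Fubini') measurable
  also have "\<dots> = (\<integral>\<^sup>+x. \<integral>\<^sup>+y. \<integral>\<^sup>+x'. \<integral>\<^sup>+s. G x (s - x * y) * G x' (s - x' * y) * ennreal \<bar>x - x'\<bar> \<partial>lborel \<partial>lborel \<partial>lborel \<partial>lborel)"
    by (intro nn_integral_cong lborel_pair.Fubini') measurable
  also have "\<dots> = (\<integral>\<^sup>+x. \<integral>\<^sup>+x'. \<integral>\<^sup>+y. \<integral>\<^sup>+s. G x (s - x * y) * G x' (s - x' * y) * ennreal \<bar>x - x'\<bar> \<partial>lborel \<partial>lborel \<partial>lborel \<partial>lborel)"
    by (intro nn_integral_cong lborel_pair.Fubini') measurable
  also have "\<dots> \<le> (\<integral>\<^sup>+x. \<integral>\<^sup>+x'. g x * g x' \<partial>lborel \<partial>lborel)"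
    by (intro nn_integral_mono *)
  also have "\<dots> = (\<integral>\<^sup>+x. g x \<partial>lborel)\<^sup>2"
    by (simp add: nn_integral_cmult nn_integral_multc power2_eq_square)
  finally show ?thesis by (simp add: g_def mult_left_mono)
qed

text \<open>With s = t + xy/2 the arguments become (y, s) and (x, s - xy), so integration in x
  produces the Radon transform of G^(2/3). Hoelder with exponents 3/2 and 3 and the bound for that
  transform finish; the constant is 8^(1/3) = 2.\<close>

lemma planar_bilinear:
  fixes F G :: "real \<Rightarrow> real \<Rightarrow> ennreal"
  assumes [measurable]: "(\<lambda>(y, s). F y s) \<in> borel_measurable (borel \<Otimes>\<^sub>M borel)"
      "(\<lambda>(x, s). G x s) \<in> borel_measurable (borel \<Otimes>\<^sub>M borel)"
  shows "(\<integral>\<^sup>+t. \<integral>\<^sup>+y. \<integral>\<^sup>+x. F y (t + 1/2 * x * y) powre (2/3) * G x (t - 1/2 * x * y) powre (2/3) \<partial>lborel \<partial>lborel \<partial>lborel)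
    \<le> 2 * (\<integral>\<^sup>+y. \<integral>\<^sup>+s. F y s \<partial>lborel \<partial>lborel) powre (2/3) * (\<integral>\<^sup>+x. \<integral>\<^sup>+s. G x s \<partial>lborel \<partial>lborel) powre (2/3)"
proof -
  define H where "H y s = (\<integral>\<^sup>+x. G x (s - x * y) powre (2/3) \<partial>lborel)" for y s
  have [measurable]: "(\<lambda>(y, s). H y s) \<in> borel_measurable (borel \<Otimes>\<^sub>M borel)"
    unfolding H_def by measurable
  have "(\<integral>\<^sup>+t. \<integral>\<^sup>+y. \<integral>\<^sup>+x. F y (t + 1/2 * x * y) powre (2/3) * G x (t - 1/2 * x * y) powre (2/3) \<partial>lborel \<partial>lborel \<partial>lborel)
     = (\<integral>\<^sup>+y. \<integral>\<^sup>+t. \<integral>\<^sup>+x. F y (t + 1/2 * x * y) powre (2/3) * G x (t - 1/2 * x * y) powre (2/3) \<partial>lborel \<partial>lborel \<partial>lborel)"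
    by (intro lborel_pair.Fubini') measurable
  also have "\<dots> = (\<integral>\<^sup>+y. \<integral>\<^sup>+x. \<integral>\<^sup>+t. F y (t + 1/2 * x * y) powre (2/3) * G x (t - 1/2 * x * y) powre (2/3) \<partial>lborel \<partial>lborel \<partial>lborel)"
    by (intro nn_integral_cong lborel_pair.Fubini') measurable
  also have "\<dots> = (\<integral>\<^sup>+y. \<integral>\<^sup>+x. \<integral>\<^sup>+s. F y s powre (2/3) * G x (s - x * y) powre (2/3) \<partial>lborel \<partial>lborel \<partial>lborel)"
  proof (rule nn_integral_cong, rule nn_integral_cong)
    fix x y
    show "(\<integral>\<^sup>+t. F y (t + 1/2 * x * y) powre (2/3) * G x (t - 1/2 * x * y) powre (2/3) \<partial>lborel)
      = (\<integral>\<^sup>+s. F y s powre (2/3) * G x (s - x * y) powre (2/3) \<partial>lborel)"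
      by (subst nn_integral_lborel_shift[symmetric, where c = "1/2 * x * y" and f = "\<lambda>s. F y s powre (2/3) * G x (s - x * y) powre (2/3)"])
        (auto simp: algebra_simps)
  qed
  also have "\<dots> = (\<integral>\<^sup>+y. \<integral>\<^sup>+s. \<integral>\<^sup>+x. F y s powre (2/3) * G x (s - x * y) powre (2/3) \<partial>lborel \<partial>lborel \<partial>lborel)"
    by (intro nn_integral_cong lborel_pair.Fubini') measurable
  also have "\<dots> = (\<integral>\<^sup>+y. \<integral>\<^sup>+s. F y s powre (2/3) * (H y s ^ 3) powre (1/3) \<partial>lborel \<partial>lborel)"
    by (simp add: nn_integral_cmult H_def ennreal_powr_powr flip: ennreal_powr_numeral)
  also have "\<dots> = (\<integral>\<^sup>+z. F (fst z) (snd z) powre (2/3) * (H (fst z) (snd z) ^ 3) powre (1/3) \<partial>(lborel \<Otimes>\<^sub>M lborel))"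
    by (subst lborel.nn_integral_fst[symmetric]) auto
  also have "\<dots> \<le> (\<integral>\<^sup>+z. F (fst z) (snd z) \<partial>(lborel \<Otimes>\<^sub>M lborel)) powre (2/3) * (\<integral>\<^sup>+z. H (fst z) (snd z) ^ 3 \<partial>(lborel \<Otimes>\<^sub>M lborel)) powre (1/3)"
    by (rule nn_integral_Holder) auto
  also have "(\<integral>\<^sup>+z. F (fst z) (snd z) \<partial>(lborel \<Otimes>\<^sub>M lborel)) = (\<integral>\<^sup>+y. \<integral>\<^sup>+s. F y s \<partial>lborel \<partial>lborel)"
    by (subst lborel.nn_integral_fst[symmetric]) auto
  also have "(\<integral>\<^sup>+z. H (fst z) (snd z) ^ 3 \<partial>(lborel \<Otimes>\<^sub>M lborel)) = (\<integral>\<^sup>+y. \<integral>\<^sup>+s. H y s ^ 3 \<partial>lborel \<partial>lborel)"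
    by (subst lborel.nn_integral_fst[symmetric]) auto
  also have "(\<integral>\<^sup>+y. \<integral>\<^sup>+s. H y s ^ 3 \<partial>lborel \<partial>lborel) powre (1/3) \<le> (8 * (\<integral>\<^sup>+x. \<integral>\<^sup>+s. G x s \<partial>lborel \<partial>lborel)\<^sup>2) powre (1/3)"
    unfolding H_def by (intro ennreal_powr_mono planar_Radon) auto
  also have "\<dots> = 2 * (\<integral>\<^sup>+x. \<integral>\<^sup>+s. G x s \<partial>lborel \<partial>lborel) powre (2/3)"
  proof -
    have "(8 :: ennreal) = 2 powre 3" by (simp add: ennreal_powr_numeral)
    then have "(8 :: ennreal) powre (1/3) = 2" by (simp only: ennreal_powr_powr) simp
    then show ?thesis by (simp add: ennreal_powr_mult ennreal_powr_powr flip: ennreal_powr_numeral)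
  qed
  finally show ?thesis by (simp add: ac_simps mult_left_mono mult_right_mono)
qed

section \<open>Fibrewise estimates on product spaces\<close>

text \<open>Finner's generalisation of the Loomis--Whitney inequality.\<close>

lemma (in product_sigma_finite) nn_integral_Finner:
  fixes \<Phi> :: "'j \<Rightarrow> ('i \<Rightarrow> 'a) \<Rightarrow> ennreal"
  assumes "finite I" "finite J" "\<And>j. j \<in> J \<Longrightarrow> S j \<subseteq> I" "\<And>j. j \<in> J \<Longrightarrow> c j > 0"
    and "\<And>i. i \<in> I \<Longrightarrow> (\<Sum>j\<in>{j \<in> J. i \<in> S j}. c j) = 1"
    and "\<And>j. j \<in> J \<Longrightarrow> \<Phi> j \<in> borel_measurable (PiM (S j) M)"
  shows "(\<integral>\<^sup>+x. (\<Prod>j\<in>J. \<Phi> j (restrict x (S j)) powre c j) \<partial>PiM I M)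
    \<le> (\<Prod>j\<in>J. (\<integral>\<^sup>+x. \<Phi> j x \<partial>PiM (S j) M) powre c j)"
  using assms(1,3,5,6)
proof (induction I arbitrary: S \<Phi> rule: finite_induct)
  case empty
  then have "S j = {}" if "j \<in> J" for j using that by blast
  then show ?case by (simp add: PiM_empty nn_integral_count_space_finite cong: prod.cong)
next
  case (insert i I)
  note [measurable] = insert.prems(3)
  define J1 where "J1 = {j \<in> J. i \<in> S j}"
  define S' where "S' j = S j - {i}" for j
  have fin: "finite (S' j)" if "j \<in> J" for j
    using finite_subset[OF insert.prems(1)[OF that]] insert.hyps by (simp add: S'_def)
  have S_insert: "S j = insert i (S' j)" if "j \<in> J1" for j
    using that by (auto simp: J1_def S'_def)
  \<comment> \<open>Coordinate \<open>i\<close> is integrated out of exactly those factors that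
    depend on it, so that \<open>\<Phi>' j\<close> lives on \<open>S j - {i}\<close>. By Tonelli its
    total integral is still that of \<open>\<Phi> j\<close>.\<close>
  define \<Phi>' where "\<Phi>' j y = (if j \<in> J1 then \<integral>\<^sup>+u. \<Phi> j (y(i := u)) \<partial>M i else \<Phi> j y)" for j y
  have J1: "J1 \<subseteq> J" "finite J1" using assms(2) by (auto simp: J1_def)
  have meas1: "(\<lambda>(y, u). \<Phi> j (y(i := u))) \<in> borel_measurable (PiM (S' j) M \<Otimes>\<^sub>M M i)" if "j \<in> J1" for j
  proof -
    have "\<Phi> j \<in> borel_measurable (PiM (insert i (S' j)) M)"
      using insert.prems(3)[of j] that J1 by (simp add: S_insert[symmetric] subset_eq)
    from measurable_compose[OF measurable_add_dim this] show ?thesis by (simp add: case_prod_unfold)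
  qed
  have meas': "\<Phi>' j \<in> borel_measurable (PiM (S' j) M)" if "j \<in> J" for j
  proof (cases "j \<in> J1")
    case True
    then have "\<Phi>' j = (\<lambda>y. \<integral>\<^sup>+u. \<Phi> j (y(i := u)) \<partial>M i)"
      by (intro ext) (simp add: \<Phi>'_def)
    then show ?thesis using M.borel_measurable_nn_integral[OF meas1[OF True]] by simp
  next
    case False
    then show ?thesis using insert.prems(3)[OF that] that by (simp add: \<Phi>'_def[abs_def] S'_def J1_def)
  qed
  have int': "(\<integral>\<^sup>+x. \<Phi>' j x \<partial>PiM (S' j) M) = (\<integral>\<^sup>+x. \<Phi> j x \<partial>PiM (S j) M)" if "j \<in> J" for j
  proof (cases "j \<in> J1")
    case True
    then have "(\<integral>\<^sup>+x. \<Phi> j x \<partial>PiM (S j) M) = (\<integral>\<^sup>+x. \<Phi> j x \<partial>PiM (insert i (S' j)) M)"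
      by (simp add: S_insert)
    also have "\<dots> = (\<integral>\<^sup>+x. \<Phi>' j x \<partial>PiM (S' j) M)"
    proof -
      have "i \<notin> S' j" by (simp add: S'_def)
      moreover have "\<Phi> j \<in> borel_measurable (PiM (insert i (S' j)) M)"
        using insert.prems(3)[OF that] S_insert[OF True] by simp
      ultimately show ?thesis
        using True fin[OF that] by (simp add: product_nn_integral_insert \<Phi>'_def)
    qed
    finally show ?thesis ..
  next
    case False
    then show ?thesis using that by (simp add: \<Phi>'_def S'_def J1_def)
  qed
  have "(\<integral>\<^sup>+x. (\<Prod>j\<in>J. \<Phi> j (restrict x (S j)) powre c j) \<partial>PiM (insert i I) M)
      = (\<integral>\<^sup>+x. (\<integral>\<^sup>+u. (\<Prod>j\<in>J. \<Phi> j (restrict (x(i := u)) (S j)) powre c j) \<partial>M i) \<partial>PiM I M)"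
  proof (rule product_nn_integral_insert)
    show "(\<lambda>x. \<Prod>j\<in>J. \<Phi> j (restrict x (S j)) powre c j) \<in> borel_measurable (PiM (insert i I) M)"
      using insert.prems(1,3)
      by (intro borel_measurable_prod_ennreal measurable_ennreal_powr measurable_compose[OF measurable_restrict_subset])
  qed (use insert.hyps in auto)
  also have "\<dots> \<le> (\<integral>\<^sup>+x. (\<Prod>j\<in>J. \<Phi>' j (restrict x (S' j)) powre c j) \<partial>PiM I M)"
  proof (rule nn_integral_mono)
    fix x assume x: "x \<in> space (PiM I M)"
    have m: "(\<lambda>u. \<Phi> j ((restrict x (S' j))(i := u))) \<in> borel_measurable (M i)" if "j \<in> J1" for j
    proof -
      have "restrict x (S' j) \<in> space (PiM (S' j) M)"
        using x insert.prems(1)[of j] that J1 by (auto simp: space_PiM S'_def PiE_iff)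
      from measurable_compose[OF measurable_Pair1'[OF this] meas1[OF that]] show ?thesis by simp
    qed
    have "(\<integral>\<^sup>+u. (\<Prod>j\<in>J. \<Phi> j (restrict (x(i := u)) (S j)) powre c j) \<partial>M i)
       = (\<integral>\<^sup>+u. (\<Prod>j\<in>J - J1. \<Phi>' j (restrict x (S' j)) powre c j) *
           (\<Prod>j\<in>J1. \<Phi> j ((restrict x (S' j))(i := u)) powre c j) \<partial>M i)"
    proof (rule nn_integral_cong)
      fix u
      have "(\<Prod>j\<in>J1. \<Phi> j (restrict (x(i := u)) (S j)) powre c j)
          = (\<Prod>j\<in>J1. \<Phi> j ((restrict x (S' j))(i := u)) powre c j)"
      proof (rule prod.cong[OF refl])
        fix j assume "j \<in> J1"
        then have "restrict (x(i := u)) (S j) = (restrict x (S' j))(i := u)"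
          by (auto simp: fun_eq_iff S'_def J1_def)
        then show "\<Phi> j (restrict (x(i := u)) (S j)) powre c j = \<Phi> j ((restrict x (S' j))(i := u)) powre c j"
          by simp
      qed
      moreover have "(\<Prod>j\<in>J - J1. \<Phi> j (restrict (x(i := u)) (S j)) powre c j)
          = (\<Prod>j\<in>J - J1. \<Phi>' j (restrict x (S' j)) powre c j)"
      proof (rule prod.cong[OF refl])
        fix j assume "j \<in> J - J1"
        then have "restrict (x(i := u)) (S j) = restrict x (S' j)" "\<Phi>' j = \<Phi> j"
          by (auto simp: fun_eq_iff S'_def J1_def \<Phi>'_def)
        then show "\<Phi> j (restrict (x(i := u)) (S j)) powre c j = \<Phi>' j (restrict x (S' j)) powre c j"
          by simp
      qed
      ultimately show "(\<Prod>j\<in>J. \<Phi> j (restrict (x(i := u)) (S j)) powre c j)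
          = (\<Prod>j\<in>J - J1. \<Phi>' j (restrict x (S' j)) powre c j) *
           (\<Prod>j\<in>J1. \<Phi> j ((restrict x (S' j))(i := u)) powre c j)"
        using prod.subset_diff[OF J1(1) assms(2), of "\<lambda>j. \<Phi> j (restrict (x(i := u)) (S j)) powre c j"] by simp
    qed
    also have "\<dots> = (\<Prod>j\<in>J - J1. \<Phi>' j (restrict x (S' j)) powre c j) *
        (\<integral>\<^sup>+u. (\<Prod>j\<in>J1. \<Phi> j ((restrict x (S' j))(i := u)) powre c j) \<partial>M i)"
      using m by (intro nn_integral_cmult borel_measurable_prod_ennreal measurable_ennreal_powr)
    \<comment> \<open>The covering condition at \<open>i\<close> says that the weights over
      \<open>J1\<close> sum to 1, which is what Hoelder's inequality in this one variable
      requires.\<close>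
    also have "\<dots> \<le> (\<Prod>j\<in>J - J1. \<Phi>' j (restrict x (S' j)) powre c j) *
        (\<Prod>j\<in>J1. (\<integral>\<^sup>+u. \<Phi> j ((restrict x (S' j))(i := u)) \<partial>M i) powre c j)"
      using m J1 assms(4) insert.prems(2)[of i]
      by (intro mult_left_mono nn_integral_Holder_prod) (auto simp: J1_def)
    also have "\<dots> = (\<Prod>j\<in>J - J1. \<Phi>' j (restrict x (S' j)) powre c j) * (\<Prod>j\<in>J1. \<Phi>' j (restrict x (S' j)) powre c j)"
      by (simp add: \<Phi>'_def)
    also have "\<dots> = (\<Prod>j\<in>J. \<Phi>' j (restrict x (S' j)) powre c j)"
      by (rule prod.subset_diff[OF J1(1) assms(2), symmetric])
    finally show "(\<integral>\<^sup>+u. (\<Prod>j\<in>J. \<Phi> j (restrict (x(i := u)) (S j)) powre c j) \<partial>M i)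
      \<le> (\<Prod>j\<in>J. \<Phi>' j (restrict x (S' j)) powre c j)" .
  qed
  also have "\<dots> \<le> (\<Prod>j\<in>J. (\<integral>\<^sup>+x. \<Phi>' j x \<partial>PiM (S' j) M) powre c j)"
  proof (rule insert.IH)
    fix k assume k: "k \<in> I"
    then have "k \<noteq> i" using insert.hyps by blast
    then have "{j \<in> J. k \<in> S' j} = {j \<in> J. k \<in> S j}" by (auto simp: S'_def)
    then show "(\<Sum>j\<in>{j \<in> J. k \<in> S' j}. c j) = 1" using insert.prems(2)[of k] k by simp
  qed (use insert.prems(1) meas' in \<open>auto simp: S'_def\<close>)
  also have "\<dots> = (\<Prod>j\<in>J. (\<integral>\<^sup>+x. \<Phi> j x \<partial>PiM (S j) M) powre c j)"
    by (simp add: int')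
  finally show ?case .
qed

text \<open>It suffices to compare boxes: the preimage of a box is the box with its sides carried
  along \<open>h\<close>, and corresponding factors have the same measure. This serves to renumber
  the coordinates that remain after one is omitted.\<close>

lemma (in product_sigma_finite) distr_PiM_reindex_bij:
  assumes h: "bij_betw h I K" and "finite I" and M: "\<And>i. i \<in> I \<Longrightarrow> M (h i) = M i"
  shows "distr (PiM K M) (PiM I M) (\<lambda>q. \<lambda>i\<in>I. q (h i)) = PiM I M"
proof (rule PiM_eqI)
  have K: "finite K" "K = h ` I" "inj_on h I" using h assms(2) by (auto simp: bij_betw_def)
  have meas: "(\<lambda>q. \<lambda>i\<in>I. q (h i)) \<in> measurable (PiM K M) (PiM I M)"
  proof (rule measurable_restrict)
    fix i assume "i \<in> I"
    then show "(\<lambda>q. q (h i)) \<in> measurable (PiM K M) (M i)"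
      using measurable_component_singleton[of "h i" K M] K M by auto
  qed
  fix A assume A: "\<And>i. i \<in> I \<Longrightarrow> A i \<in> sets (M i)"
  define B where "B k = A (inv_into I h k)" for k
  have B: "B (h i) = A i" if "i \<in> I" for i using that K by (simp add: B_def)
  have "emeasure (distr (PiM K M) (PiM I M) (\<lambda>q. \<lambda>i\<in>I. q (h i))) (Pi\<^sub>E I A)
      = emeasure (PiM K M) ((\<lambda>q. \<lambda>i\<in>I. q (h i)) -` Pi\<^sub>E I A \<inter> space (PiM K M))"
    using A assms(2) by (intro emeasure_distr meas sets_PiM_I_finite) auto
  also have "(\<lambda>q. \<lambda>i\<in>I. q (h i)) -` Pi\<^sub>E I A \<inter> space (PiM K M) = Pi\<^sub>E K B"
  proof -
    have sub: "y \<in> space (M (h i))" if "i \<in> I" "y \<in> A i" for i y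
      using A[OF that(1), THEN sets.sets_into_space] M[OF that(1)] that by auto
    show ?thesis
      unfolding K(2) by (auto simp: space_PiM PiE_iff B intro: sub)
  qed
  also have "emeasure (PiM K M) (Pi\<^sub>E K B) = (\<Prod>k\<in>K. emeasure (M k) (B k))"
    using K A B M by (intro emeasure_PiM) auto
  also have "\<dots> = (\<Prod>i\<in>I. emeasure (M i) (A i))"
    using prod.reindex_bij_betw[OF h, of "\<lambda>k. emeasure (M k) (B k)"] B M by (simp cong: prod.cong)
  finally show "emeasure (distr (PiM K M) (PiM I M) (\<lambda>q. \<lambda>i\<in>I. q (h i))) (Pi\<^sub>E I A) = (\<Prod>i\<in>I. emeasure (M i) (A i))" .
qed (use assms in auto)

section \<open>Lebesgue measure on products of lines and shears of one coordinate\<close>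

abbreviation lborel_PiM :: "'i set \<Rightarrow> ('i \<Rightarrow> real) measure" where
  "lborel_PiM I \<equiv> PiM I (\<lambda>_. lborel)"

lemma product_sigma_finite_lborel: "product_sigma_finite (\<lambda>_. lborel :: real measure)"
  by standard

lemma measurable_lborel_PiM_upd [measurable (raw)]:
  assumes "f \<in> measurable N (lborel_PiM I)" "h \<in> borel_measurable N"
  shows "(\<lambda>x. (f x)(i := h x)) \<in> measurable N (lborel_PiM (insert i I))"
  using assms by (intro measurable_fun_upd[where J = I]) auto

lemma measurable_shear:
  assumes [measurable]: "s \<in> borel_measurable (lborel_PiM D)" and "T \<in> D" "B \<subseteq> D"
  shows "(\<lambda>p. restrict (p(T := p T + s p)) B) \<in> measurable (lborel_PiM D) (lborel_PiM B)"
proof (rule measurable_restrict)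
  fix i assume "i \<in> B"
  then have [measurable]: "T \<in> D" "i \<in> D" using assms by auto
  show "(\<lambda>p. (p(T := p T + s p)) i) \<in> measurable (lborel_PiM D) lborel"
    by (cases "i = T") auto
qed

lemma nn_integral_lborel_PiM_insert2:
  assumes "finite W" "a \<notin> W" "b \<notin> W" "a \<noteq> b"
    and [measurable]: "f \<in> borel_measurable (lborel_PiM (insert b (insert a W)))"
  shows "(\<integral>\<^sup>+x. f x \<partial>lborel_PiM (insert b (insert a W)))
    = (\<integral>\<^sup>+w. \<integral>\<^sup>+u. \<integral>\<^sup>+v. f (w(a := u, b := v)) \<partial>lborel \<partial>lborel \<partial>lborel_PiM W)"
  using assms by (simp add: product_sigma_finite.product_nn_integral_insert[OF product_sigma_finite_lborel])

lemma nn_integral_lborel_PiM_insert3: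
  assumes "finite W" "a \<notin> W" "b \<notin> W" "c \<notin> W" "a \<noteq> b" "a \<noteq> c" "b \<noteq> c"
    and [measurable]: "f \<in> borel_measurable (lborel_PiM (insert c (insert b (insert a W))))"
  shows "(\<integral>\<^sup>+x. f x \<partial>lborel_PiM (insert c (insert b (insert a W))))
    = (\<integral>\<^sup>+w. \<integral>\<^sup>+u. \<integral>\<^sup>+v. \<integral>\<^sup>+z. f (w(a := u, b := v, c := z)) \<partial>lborel \<partial>lborel \<partial>lborel \<partial>lborel_PiM W)"
proof -
  have "(\<integral>\<^sup>+x. f x \<partial>lborel_PiM (insert c (insert b (insert a W))))
      = (\<integral>\<^sup>+x. (\<integral>\<^sup>+z. f (x(c := z)) \<partial>lborel) \<partial>lborel_PiM (insert b (insert a W)))"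
    using assms by (intro product_sigma_finite.product_nn_integral_insert[OF product_sigma_finite_lborel]) auto
  also have "\<dots> = (\<integral>\<^sup>+w. \<integral>\<^sup>+u. \<integral>\<^sup>+v. \<integral>\<^sup>+z. f (w(a := u, b := v, c := z)) \<partial>lborel \<partial>lborel \<partial>lborel \<partial>lborel_PiM W)"
    using assms(1-7) by (intro nn_integral_lborel_PiM_insert2) measurable
  finally show ?thesis .
qed

text \<open>With the coordinates in \<open>W\<close> frozen, the integral over the three others is
  the planar bilinear form, and \<open>planar_bilinear\<close> applies on each fibre. The weight
  \<open>H\<close> is constant on the fibres; it makes room for powers of fibre integrals.\<close>

lemma nn_integral_shear_pair_le:
  fixes a b T :: 'i
  assumes W: "finite W" "a \<notin> W" "b \<notin> W" "T \<notin> W" "a \<noteq> b" "a \<noteq> T" "b \<noteq> T"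
    and D: "D = insert a (insert b (insert T W))" "A = insert a (insert T W)" "B = insert b (insert T W)"
    and FGH [measurable]: "F \<in> borel_measurable (lborel_PiM B)" "G \<in> borel_measurable (lborel_PiM A)"
      "H \<in> borel_measurable (lborel_PiM W)"
  shows "(\<integral>\<^sup>+p. F (restrict (p(T := p T + 1/2 * p a * p b)) B) powre (2/3) *
      G (restrict (p(T := p T - 1/2 * p a * p b)) A) powre (2/3) * H (restrict p W) \<partial>lborel_PiM D)
    \<le> 2 * (\<integral>\<^sup>+w. H w * (\<integral>\<^sup>+y. \<integral>\<^sup>+t. F (w(b := y, T := t)) \<partial>lborel \<partial>lborel) powre (2/3) *
        (\<integral>\<^sup>+x. \<integral>\<^sup>+t. G (w(a := x, T := t)) \<partial>lborel \<partial>lborel) powre (2/3) \<partial>lborel_PiM W)"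
    (is "(\<integral>\<^sup>+p. ?f p \<partial>_) \<le> _")
proof -
  have [measurable]: "a \<in> D" "b \<in> D" "T \<in> D" using D by auto
  have "A \<subseteq> D" "B \<subseteq> D" unfolding D by auto
  then have [measurable]: "(\<lambda>p. F (restrict (p(T := p T + 1/2 * p a * p b)) B)) \<in> borel_measurable (lborel_PiM D)"
    "(\<lambda>p. G (restrict (p(T := p T + - (1/2 * p a * p b))) A)) \<in> borel_measurable (lborel_PiM D)"
    by (intro measurable_compose[OF measurable_shear FGH(1)] measurable_compose[OF measurable_shear FGH(2)]; measurable)+
  then have [measurable]: "(\<lambda>p. G (restrict (p(T := p T - 1/2 * p a * p b)) A)) \<in> borel_measurable (lborel_PiM D)"
    by simp
  have [measurable]: "(\<lambda>p. H (restrict p W)) \<in> borel_measurable (lborel_PiM D)"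
    by (intro measurable_compose[OF measurable_restrict_subset]) (auto simp: D)
  have F': "F \<in> borel_measurable (lborel_PiM (insert T (insert b W)))"
    and G': "G \<in> borel_measurable (lborel_PiM (insert T (insert a W)))"
    using FGH by (simp_all only: D insert_commute[of T])
  have "(\<integral>\<^sup>+p. ?f p \<partial>lborel_PiM D) =
    (\<integral>\<^sup>+w. \<integral>\<^sup>+t. \<integral>\<^sup>+y. \<integral>\<^sup>+x. ?f (w(T := t, b := y, a := x)) \<partial>lborel \<partial>lborel \<partial>lborel \<partial>lborel_PiM W)"
  proof -
    have "?f \<in> borel_measurable (lborel_PiM D)" by measurable
    then show ?thesis unfolding D(1)
      by (rule nn_integral_lborel_PiM_insert3[OF W(1) W(4) W(3) W(2) W(7)[symmetric] W(6)[symmetric] W(5)[symmetric]])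
  qed
  also have "\<dots> = (\<integral>\<^sup>+w. \<integral>\<^sup>+t. \<integral>\<^sup>+y. \<integral>\<^sup>+x. H w * (F (w(b := y, T := t + 1/2 * x * y)) powre (2/3) *
      G (w(a := x, T := t - 1/2 * x * y)) powre (2/3)) \<partial>lborel \<partial>lborel \<partial>lborel \<partial>lborel_PiM W)"
  proof (rule nn_integral_cong, rule nn_integral_cong, rule nn_integral_cong, rule nn_integral_cong)
    fix w t y x assume w: "w \<in> space (lborel_PiM W)"
    let ?p = "w(T := t, b := y, a := x)"
    \<comment> \<open>The restricted points are compared as total functions, hence also off the
      index set, where both sides equal \<open>undefined\<close>.\<close>
    have ext: "w i = undefined" if "i \<notin> W" for i using w that by (auto simp: space_PiM PiE_iff extensional_def)
    have "restrict (?p(T := ?p T + 1/2 * ?p a * ?p b)) B = w(b := y, T := t + 1/2 * x * y)"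
      "restrict (?p(T := ?p T - 1/2 * ?p a * ?p b)) A = w(a := x, T := t - 1/2 * x * y)"
      "restrict ?p W = w"
      using W ext by (auto simp: D fun_eq_iff restrict_def)
    then show "?f ?p = H w * (F (w(b := y, T := t + 1/2 * x * y)) powre (2/3) *
      G (w(a := x, T := t - 1/2 * x * y)) powre (2/3))"
      by (simp only: mult_ac)
  qed
  also have "\<dots> \<le> (\<integral>\<^sup>+w. H w * (2 * (\<integral>\<^sup>+y. \<integral>\<^sup>+t. F (w(b := y, T := t)) \<partial>lborel \<partial>lborel) powre (2/3) *
        (\<integral>\<^sup>+x. \<integral>\<^sup>+t. G (w(a := x, T := t)) \<partial>lborel \<partial>lborel) powre (2/3)) \<partial>lborel_PiM W)"
  proof (rule nn_integral_mono)
    fix w assume w [measurable]: "w \<in> space (lborel_PiM W)"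
    have c: "(\<lambda>_. w) \<in> measurable N (lborel_PiM W)" for N using w by simp
    have [measurable]: "(\<lambda>z. F (w(b := fst z, T := snd z))) \<in> borel_measurable (borel \<Otimes>\<^sub>M borel)"
      "(\<lambda>z. G (w(a := fst z, T := snd z))) \<in> borel_measurable (borel \<Otimes>\<^sub>M borel)"
      by (intro measurable_compose[OF _ F'] measurable_compose[OF _ G'] measurable_lborel_PiM_upd c; measurable)+
    have mF: "(\<lambda>(y, t). F (w(b := y, T := t))) \<in> borel_measurable (borel \<Otimes>\<^sub>M borel)"
      and mG: "(\<lambda>(y, t). G (w(a := y, T := t))) \<in> borel_measurable (borel \<Otimes>\<^sub>M borel)"
      unfolding case_prod_unfold by measurable
    have "(\<integral>\<^sup>+t. \<integral>\<^sup>+y. \<integral>\<^sup>+x. H w * (F (w(b := y, T := t + 1/2 * x * y)) powre (2/3) *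
        G (w(a := x, T := t - 1/2 * x * y)) powre (2/3)) \<partial>lborel \<partial>lborel \<partial>lborel)
      = H w * (\<integral>\<^sup>+t. \<integral>\<^sup>+y. \<integral>\<^sup>+x. F (w(b := y, T := t + 1/2 * x * y)) powre (2/3) *
        G (w(a := x, T := t - 1/2 * x * y)) powre (2/3) \<partial>lborel \<partial>lborel \<partial>lborel)"
    proof -
      have [measurable (raw)]: "(\<lambda>x. F (w(b := f x, T := g x))) \<in> borel_measurable N"
        if "f \<in> borel_measurable N" "g \<in> borel_measurable N" for f g and N :: "(((real \<times> real) \<times> real)) measure"
        using measurable_compose[OF measurable_Pair[OF that] mF] by simp
      have [measurable (raw)]: "(\<lambda>x. G (w(a := f x, T := g x))) \<in> borel_measurable N"
        if "f \<in> borel_measurable N" "g \<in> borel_measurable N" for f g and N :: "(((real \<times> real) \<times> real)) measure"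
        using measurable_compose[OF measurable_Pair[OF that] mG] by simp
      define K where "K = (\<lambda>((t, y), x). F (w(b := y, T := t + 1/2 * x * y)) powre (2/3) *
        G (w(a := x, T := t - 1/2 * x * y)) powre (2/3))"
      have [measurable]: "K \<in> borel_measurable ((borel \<Otimes>\<^sub>M borel) \<Otimes>\<^sub>M borel)"
        unfolding K_def case_prod_unfold by measurable
      have "(\<integral>\<^sup>+t. \<integral>\<^sup>+y. \<integral>\<^sup>+x. H w * K ((t, y), x) \<partial>lborel \<partial>lborel \<partial>lborel)
        = H w * (\<integral>\<^sup>+t. \<integral>\<^sup>+y. \<integral>\<^sup>+x. K ((t, y), x) \<partial>lborel \<partial>lborel \<partial>lborel)"
        by (simp add: nn_integral_cmult)
      then show ?thesis by (simp add: K_def)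
    qed
    also have "\<dots> \<le> H w * (2 * (\<integral>\<^sup>+y. \<integral>\<^sup>+t. F (w(b := y, T := t)) \<partial>lborel \<partial>lborel) powre (2/3) *
        (\<integral>\<^sup>+x. \<integral>\<^sup>+t. G (w(a := x, T := t)) \<partial>lborel \<partial>lborel) powre (2/3))"
      by (intro mult_left_mono planar_bilinear mF mG) simp
    finally show "(\<integral>\<^sup>+t. \<integral>\<^sup>+y. \<integral>\<^sup>+x. H w * (F (w(b := y, T := t + 1/2 * x * y)) powre (2/3) *
        G (w(a := x, T := t - 1/2 * x * y)) powre (2/3)) \<partial>lborel \<partial>lborel \<partial>lborel)
      \<le> H w * (2 * (\<integral>\<^sup>+y. \<integral>\<^sup>+t. F (w(b := y, T := t)) \<partial>lborel \<partial>lborel) powre (2/3) *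
        (\<integral>\<^sup>+x. \<integral>\<^sup>+t. G (w(a := x, T := t)) \<partial>lborel \<partial>lborel) powre (2/3))" .
  qed
  also have "\<dots> = (\<integral>\<^sup>+w. 2 * (H w * (\<integral>\<^sup>+y. \<integral>\<^sup>+t. F (w(b := y, T := t)) \<partial>lborel \<partial>lborel) powre (2/3) *
        (\<integral>\<^sup>+x. \<integral>\<^sup>+t. G (w(a := x, T := t)) \<partial>lborel \<partial>lborel) powre (2/3)) \<partial>lborel_PiM W)"
    by (simp add: ac_simps)
  also have "\<dots> = 2 * (\<integral>\<^sup>+w. H w * (\<integral>\<^sup>+y. \<integral>\<^sup>+t. F (w(b := y, T := t)) \<partial>lborel \<partial>lborel) powre (2/3) *
        (\<integral>\<^sup>+x. \<integral>\<^sup>+t. G (w(a := x, T := t)) \<partial>lborel \<partial>lborel) powre (2/3) \<partial>lborel_PiM W)"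
  proof (rule nn_integral_cmult)
    have "(\<lambda>w. \<integral>\<^sup>+y. \<integral>\<^sup>+t. F (w(b := y, T := t)) \<partial>lborel \<partial>lborel) \<in> borel_measurable (lborel_PiM W)"
      using F' by measurable
    moreover have "(\<lambda>w. \<integral>\<^sup>+x. \<integral>\<^sup>+t. G (w(a := x, T := t)) \<partial>lborel \<partial>lborel) \<in> borel_measurable (lborel_PiM W)"
      using G' by measurable
    ultimately show "(\<lambda>w. H w * (\<integral>\<^sup>+y. \<integral>\<^sup>+t. F (w(b := y, T := t)) \<partial>lborel \<partial>lborel) powre (2/3) *
        (\<integral>\<^sup>+x. \<integral>\<^sup>+t. G (w(a := x, T := t)) \<partial>lborel \<partial>lborel) powre (2/3)) \<in> borel_measurable (lborel_PiM W)"
      by measurable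
  qed
  finally show ?thesis .
qed


text \<open>On each line in direction \<open>T\<close> a shear is a translation, since
  \<open>s j\<close> does not depend on that coordinate. After Hoelder's inequality along the line,
  translation invariance therefore removes the shears altogether.\<close>

lemma nn_integral_shear_Holder:
  assumes Z: "finite Z" "T \<notin> Z" and J: "finite J" "\<And>j. j \<in> J \<Longrightarrow> c j > 0" "sum c J = 1"
    and S: "\<And>j. j \<in> J \<Longrightarrow> S j \<subseteq> Z"
    and s [measurable]: "\<And>j. j \<in> J \<Longrightarrow> s j \<in> borel_measurable (lborel_PiM (insert T Z))"
    and s_indep: "\<And>j p u. j \<in> J \<Longrightarrow> s j (p(T := u)) = s j p"
    and F: "\<And>j. j \<in> J \<Longrightarrow> F j \<in> borel_measurable (lborel_PiM (insert T (S j)))"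
    and H [measurable]: "H \<in> borel_measurable (lborel_PiM Z)"
  shows "(\<integral>\<^sup>+p. (\<Prod>j\<in>J. F j (restrict (p(T := p T + s j p)) (insert T (S j))) powre c j) * H (restrict p Z)
      \<partial>lborel_PiM (insert T Z))
    \<le> (\<integral>\<^sup>+z. (\<Prod>j\<in>J. (\<integral>\<^sup>+t. F j ((restrict z (S j))(T := t)) \<partial>lborel) powre c j) * H z \<partial>lborel_PiM Z)"
    (is "(\<integral>\<^sup>+p. ?f p \<partial>_) \<le> _")
proof -
  have mF: "(\<lambda>p. F j (restrict (p(T := p T + s j p)) (insert T (S j)))) \<in> borel_measurable (lborel_PiM (insert T Z))"
    if "j \<in> J" for j
    using S[OF that] by (intro measurable_compose[OF measurable_shear F[OF that]] s that) auto
  have "?f \<in> borel_measurable (lborel_PiM (insert T Z))"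
    by (intro borel_measurable_times_ennreal borel_measurable_prod_ennreal measurable_ennreal_powr mF
      measurable_compose[OF measurable_restrict_subset H]) auto
  then have "(\<integral>\<^sup>+p. ?f p \<partial>lborel_PiM (insert T Z)) = (\<integral>\<^sup>+z. \<integral>\<^sup>+t. ?f (z(T := t)) \<partial>lborel \<partial>lborel_PiM Z)"
    using Z by (intro product_sigma_finite.product_nn_integral_insert[OF product_sigma_finite_lborel])
  also have "\<dots> \<le> (\<integral>\<^sup>+z. (\<Prod>j\<in>J. (\<integral>\<^sup>+t. F j ((restrict z (S j))(T := t)) \<partial>lborel) powre c j) * H z \<partial>lborel_PiM Z)"
  proof (rule nn_integral_mono)
    fix z assume z: "z \<in> space (lborel_PiM Z)"
    have m: "(\<lambda>t. F j ((restrict z (S j))(T := t))) \<in> borel_measurable borel" if "j \<in> J" for j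
    proof -
      have "restrict z (S j) \<in> space (lborel_PiM (S j))" by (simp add: space_PiM)
      then show ?thesis by (intro measurable_compose[OF _ F[OF that]] measurable_lborel_PiM_upd) auto
    qed
    have "?f (z(T := t)) = (\<Prod>j\<in>J. F j ((restrict z (S j))(T := t + s j z)) powre c j) * H z" for t
    proof -
      have "restrict (z(T := t, T := (z(T := t)) T + s j (z(T := t)))) (insert T (S j)) = (restrict z (S j))(T := t + s j z)"
        if "j \<in> J" for j
        using S[OF that] Z by (auto simp: fun_eq_iff s_indep[OF that])
      moreover have "restrict (z(T := t)) Z = z"
        using z Z by (auto simp: fun_eq_iff space_PiM PiE_iff extensional_def)
      ultimately show ?thesis by (simp cong: prod.cong)
    qed
    then have "(\<integral>\<^sup>+t. ?f (z(T := t)) \<partial>lborel) = (\<integral>\<^sup>+t. (\<Prod>j\<in>J. F j ((restrict z (S j))(T := t + s j z)) powre c j) * H z \<partial>lborel)"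
      by (simp only:)
    also have "\<dots> = (\<integral>\<^sup>+t. (\<Prod>j\<in>J. F j ((restrict z (S j))(T := t + s j z)) powre c j) \<partial>lborel) * H z"
      by (intro nn_integral_multc borel_measurable_prod_ennreal measurable_ennreal_powr measurable_compose[OF _ m]) auto
    also have "\<dots> \<le> (\<Prod>j\<in>J. (\<integral>\<^sup>+t. F j ((restrict z (S j))(T := t + s j z)) \<partial>lborel) powre c j) * H z"
      using J by (intro mult_right_mono nn_integral_Holder_prod measurable_compose[OF _ m]) auto
    also have "\<dots> = (\<Prod>j\<in>J. (\<integral>\<^sup>+t. F j ((restrict z (S j))(T := t)) \<partial>lborel) powre c j) * H z"
      by (simp add: nn_integral_lborel_shift[OF m] cong: prod.cong)
    finally show "(\<integral>\<^sup>+t. ?f (z(T := t)) \<partial>lborel)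
        \<le> (\<Prod>j\<in>J. (\<integral>\<^sup>+t. F j ((restrict z (S j))(T := t)) \<partial>lborel) powre c j) * H z" .
  qed
  finally show ?thesis .
qed

text \<open>The counterpart of \<open>nn_integral_shear_pair_le\<close> without shears: over a fixed
  point of \<open>W\<close> one factor depends on y alone and the other on x alone, so the fibre
  integral splits exactly.\<close>

lemma nn_integral_product_pair:
  assumes W: "finite W" "a \<notin> W" "b \<notin> W" "a \<noteq> b"
    and [measurable]: "f \<in> borel_measurable (lborel_PiM (insert b W))" "g \<in> borel_measurable (lborel_PiM (insert a W))"
      "H \<in> borel_measurable (lborel_PiM W)"
  shows "(\<integral>\<^sup>+p. f (restrict p (insert b W)) * g (restrict p (insert a W)) * H (restrict p W) \<partial>lborel_PiM (insert a (insert b W)))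
    = (\<integral>\<^sup>+w. H w * (\<integral>\<^sup>+y. f (w(b := y)) \<partial>lborel) * (\<integral>\<^sup>+x. g (w(a := x)) \<partial>lborel) \<partial>lborel_PiM W)"
    (is "(\<integral>\<^sup>+p. ?f p \<partial>_) = _")
proof -
  have "?f \<in> borel_measurable (lborel_PiM (insert a (insert b W)))"
    by (intro borel_measurable_times_ennreal measurable_compose[OF measurable_restrict_subset assms(5)]
      measurable_compose[OF measurable_restrict_subset assms(6)] measurable_compose[OF measurable_restrict_subset assms(7)]) auto
  then have "(\<integral>\<^sup>+p. ?f p \<partial>lborel_PiM (insert a (insert b W)))
      = (\<integral>\<^sup>+w. \<integral>\<^sup>+y. \<integral>\<^sup>+x. ?f (w(b := y, a := x)) \<partial>lborel \<partial>lborel \<partial>lborel_PiM W)"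
    by (rule nn_integral_lborel_PiM_insert2[OF W(1,3,2) W(4)[symmetric]])
  also have "\<dots> = (\<integral>\<^sup>+w. H w * (\<integral>\<^sup>+y. f (w(b := y)) \<partial>lborel) * (\<integral>\<^sup>+x. g (w(a := x)) \<partial>lborel) \<partial>lborel_PiM W)"
  proof (rule nn_integral_cong)
    fix w assume w: "w \<in> space (lborel_PiM W)"
    have "restrict (w(b := y, a := x)) (insert b W) = w(b := y)" "restrict (w(b := y, a := x)) (insert a W) = w(a := x)"
      "restrict (w(b := y, a := x)) W = w" for x y
      using w W by (auto simp: fun_eq_iff space_PiM PiE_iff extensional_def)
    then have "(\<integral>\<^sup>+y. \<integral>\<^sup>+x. ?f (w(b := y, a := x)) \<partial>lborel \<partial>lborel)
        = (\<integral>\<^sup>+y. \<integral>\<^sup>+x. (H w * f (w(b := y))) * g (w(a := x)) \<partial>lborel \<partial>lborel)"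
      by (simp add: ac_simps)
    also have "\<dots> = H w * (\<integral>\<^sup>+y. f (w(b := y)) \<partial>lborel) * (\<integral>\<^sup>+x. g (w(a := x)) \<partial>lborel)"
    proof -
      have [measurable]: "(\<lambda>y. f (w(b := y))) \<in> borel_measurable borel" "(\<lambda>x. g (w(a := x))) \<in> borel_measurable borel"
        using w by (auto intro!: measurable_compose[OF _ assms(5)] measurable_compose[OF _ assms(6)] measurable_lborel_PiM_upd)
      show ?thesis by (simp add: nn_integral_cmult nn_integral_multc)
    qed
    finally show "(\<integral>\<^sup>+y. \<integral>\<^sup>+x. ?f (w(b := y, a := x)) \<partial>lborel \<partial>lborel)
        = H w * (\<integral>\<^sup>+y. f (w(b := y)) \<partial>lborel) * (\<integral>\<^sup>+x. g (w(a := x)) \<partial>lborel)" .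
  qed
  finally show ?thesis .
qed

section \<open>Vertical projections\<close>

definition partner :: "nat \<Rightarrow> nat \<Rightarrow> nat" where
  "partner n j = (if j \<le> n then n + j else j - n)"

text \<open>The set is the same for \<open>j\<close> and its partner, which puts the fibre integrals
  of both functions of a pair on one common space.\<close>

definition base :: "nat \<Rightarrow> nat \<Rightarrow> nat set" where
  "base n j = {1..2 * n} - {j, partner n j}"

text \<open>
  The projection in the coordinates \<open>{1..2n+1} - {j}\<close> themselves, without the renumbering that
  \<^const>\<open>vert_proj\<close> performs.
\<close>

definition shear_proj :: "nat \<Rightarrow> nat \<Rightarrow> (nat \<Rightarrow> real) \<Rightarrow> (nat \<Rightarrow> real)" where
  "shear_proj n j p = restrict (p(2 * n + 1 := p (2 * n + 1) +
     (if j \<le> n then 1/2 * p j * p (n + j) else - (1/2 * p (j - n) * p j)))) ({1..2 * n + 1} - {j})"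

definition vert_int :: "nat \<Rightarrow> ((nat \<Rightarrow> real) \<Rightarrow> ennreal) \<Rightarrow> (nat \<Rightarrow> real) \<Rightarrow> ennreal" where
  "vert_int n f z = (\<integral>\<^sup>+t. f (z(2 * n + 1 := t)) \<partial>lborel)"

text \<open>This is the function written \<open>\<phi>\<^sub>j\<close> in the overview.\<close>

definition fibre_int :: "nat \<Rightarrow> nat \<Rightarrow> ((nat \<Rightarrow> real) \<Rightarrow> ennreal) \<Rightarrow> (nat \<Rightarrow> real) \<Rightarrow> ennreal" where
  "fibre_int n j f w = (\<integral>\<^sup>+y. vert_int n f (w(partner n j := y)) \<partial>lborel)"

lemma partner:
  assumes "j \<in> {1..2 * n}"
  shows "partner n j \<in> {1..2 * n}" "partner n j \<noteq> j" "partner n (partner n j) = j"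
  using assms by (auto simp: partner_def)

lemma base_partner: "j \<in> {1..2 * n} \<Longrightarrow> base n (partner n j) = base n j"
  using partner[of j n] by (auto simp: base_def)

lemma base_props:
  assumes "j \<in> {1..2 * n}"
  shows "finite (base n j)" "j \<notin> base n j" "partner n j \<notin> base n j" "2 * n + 1 \<notin> base n j"
    "base n j \<subseteq> {1..2 * n}" "card (base n j) = 2 * n - 2"
proof -
  have "{j, partner n j} \<subseteq> {1..2 * n}" using assms partner(1)[OF assms] by blast
  then show "card (base n j) = 2 * n - 2"
    using partner(2)[OF assms] unfolding base_def by (subst card_Diff_subset) simp_all
  have "base n j \<subseteq> {1..2 * n}" "2 * n + 1 \<notin> {1..2 * n}" unfolding base_def by (blast, simp)
  then show "base n j \<subseteq> {1..2 * n}" "2 * n + 1 \<notin> base n j" by blast+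
qed (simp_all add: base_def)

lemma index_sets:
  assumes "j \<in> {1..2 * n}"
  shows "{1..2 * n} = insert j (insert (partner n j) (base n j))"
    "{1..2 * n} - {j} = insert (partner n j) (base n j)"
    "{1..2 * n + 1} - {j} = insert (2 * n + 1) (insert (partner n j) (base n j))"
    "{1..2 * n + 1} = insert j (insert (partner n j) (insert (2 * n + 1) (base n j)))"
    "{1..2 * n + 1} - {j} = insert (2 * n + 1) ({1..2 * n} - {j})"
proof -
  have top: "{1..2 * n + 1} = insert (2 * n + 1) {1..2 * n}" "2 * n + 1 \<notin> {1..2 * n}" by auto
  have sets: "A = insert j (insert c (A - {j, c}))" "A - {j} = insert c (A - {j, c})"
    "insert t A - {j} = insert t (insert c (A - {j, c}))"
    "insert t A = insert j (insert c (insert t (A - {j, c})))" "insert t A - {j} = insert t (A - {j})"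
    if "j \<in> A" "c \<in> A" "c \<noteq> j" "t \<notin> A" for c t and A :: "nat set"
    using that by auto
  note * = sets[OF assms partner(1,2)[OF assms] top(2)]
  show "{1..2 * n} = insert j (insert (partner n j) (base n j))"
    unfolding base_def by (rule *(1))
  show "{1..2 * n} - {j} = insert (partner n j) (base n j)"
    unfolding base_def by (rule *(2))
  show "{1..2 * n + 1} - {j} = insert (2 * n + 1) (insert (partner n j) (base n j))"
    "{1..2 * n + 1} = insert j (insert (partner n j) (insert (2 * n + 1) (base n j)))"
    "{1..2 * n + 1} - {j} = insert (2 * n + 1) ({1..2 * n} - {j})"
    unfolding base_def top(1) by (rule *(3), rule *(4), rule *(5))
qed

lemma measurable_vert_int:
  assumes j: "j \<in> {1..2 * n}" and f: "f \<in> borel_measurable (lborel_PiM ({1..2 * n + 1} - {j}))"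
  shows "vert_int n f \<in> borel_measurable (lborel_PiM ({1..2 * n} - {j}))"
proof -
  have [measurable]: "f \<in> borel_measurable (lborel_PiM (insert (2 * n + 1) ({1..2 * n} - {j})))"
    using f unfolding index_sets(5)[OF j] .
  show ?thesis unfolding vert_int_def by measurable
qed

lemma measurable_fibre_int:
  assumes j: "j \<in> {1..2 * n}" and f: "f \<in> borel_measurable (lborel_PiM ({1..2 * n + 1} - {j}))"
  shows "fibre_int n j f \<in> borel_measurable (lborel_PiM (base n j))"
proof -
  have [measurable]: "vert_int n f \<in> borel_measurable (lborel_PiM (insert (partner n j) (base n j)))"
    using measurable_vert_int[OF j f] unfolding index_sets(2)[OF j] .
  show ?thesis unfolding fibre_int_def by measurable
qed

lemma nn_integral_fibre_int:
  assumes j: "j \<in> {1..2 * n}" and f: "f \<in> borel_measurable (lborel_PiM ({1..2 * n + 1} - {j}))"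
  shows "(\<integral>\<^sup>+w. fibre_int n j f w \<partial>lborel_PiM (base n j)) = (\<integral>\<^sup>+q. f q \<partial>lborel_PiM ({1..2 * n + 1} - {j}))"
proof -
  have "partner n j \<noteq> 2 * n + 1" using partner(1)[OF j] by auto
  then show ?thesis
    unfolding index_sets(3)[OF j] fibre_int_def vert_int_def
    by (rule nn_integral_lborel_PiM_insert2[OF base_props(1,3,4)[OF j] _ f[unfolded index_sets(3)[OF j]], symmetric])
qed

lemma measurable_shear_proj:
  assumes j: "j \<in> {1..2 * n}" and f: "f \<in> borel_measurable (lborel_PiM ({1..2 * n + 1} - {j}))"
  shows "(\<lambda>p. f (shear_proj n j p)) \<in> borel_measurable (lborel_PiM {1..2 * n + 1})"
  unfolding shear_proj_def
proof (intro measurable_compose[OF measurable_shear f])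
  have [measurable]: "i \<in> {1..2 * n + 1} \<Longrightarrow> (\<lambda>p. p i) \<in> borel_measurable (lborel_PiM {1..2 * n + 1})" for i
    using measurable_component_singleton[of i "{1..2 * n + 1}" "\<lambda>_. lborel :: real measure"] by simp
  have "j \<in> {1..2 * n + 1}" "j \<le> n \<Longrightarrow> n + j \<in> {1..2 * n + 1}" "\<not> j \<le> n \<Longrightarrow> j - n \<in> {1..2 * n + 1}"
    using j by auto
  then show "(\<lambda>p. if j \<le> n then 1/2 * p j * p (n + j) else - (1/2 * p (j - n) * p j))
    \<in> borel_measurable (lborel_PiM {1..2 * n + 1})"
    by (cases "j \<le> n") (auto simp del: One_nat_def)
qed auto

lemma measurable_fibre_int_restrict:
  assumes "j \<in> {1..2 * n}" "f \<in> borel_measurable (lborel_PiM ({1..2 * n + 1} - {j}))" "base n j \<subseteq> D"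
  shows "(\<lambda>p. fibre_int n j f (restrict p (base n j))) \<in> borel_measurable (lborel_PiM D)"
  using assms by (intro measurable_compose[OF measurable_restrict_subset measurable_fibre_int])

lemma measurable_vert_int_restrict:
  assumes "j \<in> {1..2 * n}" "f \<in> borel_measurable (lborel_PiM ({1..2 * n + 1} - {j}))"
  shows "(\<lambda>p. vert_int n f (restrict p ({1..2 * n} - {j}))) \<in> borel_measurable (lborel_PiM {1..2 * n})"
  by (intro measurable_compose[OF measurable_restrict_subset measurable_vert_int] assms) auto

section \<open>Estimates for one conjugate pair\<close>

lemma prod_partner:
  fixes X :: "nat \<Rightarrow> 'a :: comm_monoid_mult"
  shows "(\<Prod>j=1..2 * n. X j) = (\<Prod>j=1..n. X j * X (n + j))"
proof -
  have "(\<Prod>j=1..2 * n. X j) = (\<Prod>j\<in>{1..n} \<union> {n + 1..2 * n}. X j)"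
    by (intro prod.cong) auto
  also have "\<dots> = (\<Prod>j=1..n. X j) * (\<Prod>j=n + 1..2 * n. X j)"
    by (intro prod.union_disjoint) auto
  also have "(\<Prod>j=n + 1..2 * n. X j) = (\<Prod>j=1..n. X (n + j))"
    using prod.shift_bounds_cl_nat_ivl[of X 1 n n] by (simp add: mult_2 add.commute)
  finally show ?thesis by (simp add: prod.distrib)
qed

abbreviation total_mass :: "nat \<Rightarrow> nat \<Rightarrow> ((nat \<Rightarrow> real) \<Rightarrow> ennreal) \<Rightarrow> ennreal" where
  "total_mass n j f \<equiv> (\<integral>\<^sup>+q. f q \<partial>lborel_PiM ({1..2 * n + 1} - {j}))"

lemma in_range: "j \<in> {1..n} \<Longrightarrow> j \<in> {1..2 * n}" "j \<in> {1..n} \<Longrightarrow> n + j \<in> {1..2 * n}"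
    "j \<in> {1..n} \<Longrightarrow> partner n j = n + j" "j \<in> {1..n} \<Longrightarrow> base n (n + j) = base n j"
  using base_partner[of j n] by (auto simp: partner_def)

lemma measurable_fibre_int_pair:
  fixes n :: nat and F :: "nat \<Rightarrow> (nat \<Rightarrow> real) \<Rightarrow> ennreal"
  assumes F: "\<And>j. j \<in> {1..2 * n} \<Longrightarrow> F j \<in> borel_measurable (lborel_PiM ({1..2 * n + 1} - {j}))"
    and j: "j \<in> {1..n}"
  shows "fibre_int n j (F j) \<in> borel_measurable (lborel_PiM (base n j))" "fibre_int n (n + j) (F (n + j)) \<in> borel_measurable (lborel_PiM (base n j))"
proof -
  note r = in_range[OF j]
  show "fibre_int n j (F j) \<in> borel_measurable (lborel_PiM (base n j))"
    by (rule measurable_fibre_int[OF r(1) F[OF r(1)]])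
  show "fibre_int n (n + j) (F (n + j)) \<in> borel_measurable (lborel_PiM (base n j))"
    by (rule measurable_fibre_int[OF r(2) F[OF r(2)], unfolded r(4)])
qed

text \<open>Over each point of \<open>base n j\<close> the projections with indices j and n + j act
  on (x_j, x_(n+j), t) as the two projections of the first Heisenberg group, so this is the
  fibrewise planar bound with a = j, b = n + j and T = 2n + 1.\<close>

lemma pair_shear_le:
  fixes n :: nat and F :: "nat \<Rightarrow> (nat \<Rightarrow> real) \<Rightarrow> ennreal"
  assumes F: "\<And>j. j \<in> {1..2 * n} \<Longrightarrow> F j \<in> borel_measurable (lborel_PiM ({1..2 * n + 1} - {j}))"
    and j: "j \<in> {1..n}" and H: "H \<in> borel_measurable (lborel_PiM (base n j))"
  shows "(\<integral>\<^sup>+p. F j (shear_proj n j p) powre (2/3) * F (n + j) (shear_proj n (n + j) p) powre (2/3) *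
      H (restrict p (base n j)) \<partial>lborel_PiM {1..2 * n + 1})
    \<le> 2 * (\<integral>\<^sup>+w. H w * fibre_int n j (F j) w powre (2/3) * fibre_int n (n + j) (F (n + j)) w powre (2/3) \<partial>lborel_PiM (base n j))"
proof -
  note r = in_range[OF j]
  note b = base_props[OF r(1)]
  have ne: "j \<noteq> n + j" "j \<noteq> 2 * n + 1" "n + j \<noteq> 2 * n + 1" using j by auto
  have p: "partner n (n + j) = j" using j by (simp add: partner_def)
  have sets: "{1..2 * n + 1} = insert j (insert (n + j) (insert (2 * n + 1) (base n j)))"
    "{1..2 * n + 1} - {n + j} = insert j (insert (2 * n + 1) (base n j))"
    "{1..2 * n + 1} - {j} = insert (n + j) (insert (2 * n + 1) (base n j))"
    by (rule index_sets(4)[OF r(1), unfolded r(3)],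
      simp_all only: index_sets(3)[OF r(1), unfolded r(3)] index_sets(3)[OF r(2), unfolded r(4) p] insert_commute[of "2 * n + 1"])
  have proj: "shear_proj n j p = restrict (p(2 * n + 1 := p (2 * n + 1) + 1/2 * p j * p (n + j))) ({1..2 * n + 1} - {j})"
    "shear_proj n (n + j) p = restrict (p(2 * n + 1 := p (2 * n + 1) - 1/2 * p j * p (n + j))) ({1..2 * n + 1} - {n + j})" for p
    using j by (auto simp: shear_proj_def)
  have marg: "fibre_int n j (F j) w = (\<integral>\<^sup>+y. \<integral>\<^sup>+t. F j (w(n + j := y, 2 * n + 1 := t)) \<partial>lborel \<partial>lborel)"
    "fibre_int n (n + j) (F (n + j)) w = (\<integral>\<^sup>+y. \<integral>\<^sup>+t. F (n + j) (w(j := y, 2 * n + 1 := t)) \<partial>lborel \<partial>lborel)" for w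
    by (simp_all add: fibre_int_def vert_int_def r p)
  show ?thesis unfolding proj marg
    by (rule nn_integral_shear_pair_le[OF b(1,2) b(3)[unfolded r(3)] b(4) ne sets F[OF r(1)] F[OF r(2)] H])
qed

text \<open>Cauchy-Schwarz on the common space \<open>base n j\<close>. Both mixed-norm estimates
  reduce each pair to this product of square roots.\<close>

lemma sqrt_mass_le:
  fixes n :: nat and F :: "nat \<Rightarrow> (nat \<Rightarrow> real) \<Rightarrow> ennreal"
  assumes F: "\<And>j. j \<in> {1..2 * n} \<Longrightarrow> F j \<in> borel_measurable (lborel_PiM ({1..2 * n + 1} - {j}))"
    and j: "j \<in> {1..n}"
  shows "(\<integral>\<^sup>+w. fibre_int n j (F j) w powre (1/2) * fibre_int n (n + j) (F (n + j)) w powre (1/2) \<partial>lborel_PiM (base n j))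
    \<le> total_mass n j (F j) powre (1/2) * total_mass n (n + j) (F (n + j)) powre (1/2)"
proof -
  note r = in_range[OF j]
  have "total_mass n j (F j) = (\<integral>\<^sup>+w. fibre_int n j (F j) w \<partial>lborel_PiM (base n j))" "total_mass n (n + j) (F (n + j)) = (\<integral>\<^sup>+w. fibre_int n (n + j) (F (n + j)) w \<partial>lborel_PiM (base n j))"
    by (rule nn_integral_fibre_int[OF r(1) F[OF r(1)], symmetric],
      rule nn_integral_fibre_int[OF r(2) F[OF r(2)], unfolded r(4), symmetric])
  then show ?thesis
    using measurable_fibre_int_pair[OF F j] by (simp add: nn_integral_Holder)
qed

section \<open>The case n = 1 and the two mixed-norm estimates\<close>

lemma vertical_inequality_one:
  fixes n :: nat and F :: "nat \<Rightarrow> (nat \<Rightarrow> real) \<Rightarrow> ennreal"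
  assumes F: "\<And>j. j \<in> {1..2 * n} \<Longrightarrow> F j \<in> borel_measurable (lborel_PiM ({1..2 * n + 1} - {j}))"
    and n: "n = 1"
  shows "(\<integral>\<^sup>+p. (\<Prod>j=1..2 * n. F j (shear_proj n j p) powre (2/3)) \<partial>lborel_PiM {1..2 * n + 1})
    \<le> 2 * (\<Prod>j=1..2 * n. total_mass n j (F j) powre (2/3))"
proof -
  have 1: "(1::nat) \<in> {1..n}" using n by simp
  note r = in_range[OF 1]
  \<comment> \<open>No coordinates are left to freeze: the base space is a single point of mass 1,
    and a fibre integral is already the total mass. The bound for one pair with weight 1 is then the
    claim.\<close>
  have e: "base n 1 = {}" "base n (n + 1) = {}" using n by (auto simp: base_def partner_def)
  have m: "total_mass n j (F j) = fibre_int n j (F j) (\<lambda>_. undefined)" if "j \<in> {1..2 * n}" "base n j = {}" for j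
    using nn_integral_fibre_int[OF that(1) F] that by (simp add: PiM_empty nn_integral_count_space_finite)
  have "(\<integral>\<^sup>+p. F 1 (shear_proj n 1 p) powre (2/3) * F (n + 1) (shear_proj n (n + 1) p) powre (2/3) *
      (\<lambda>_. 1) (restrict p (base n 1)) \<partial>lborel_PiM {1..2 * n + 1})
    \<le> 2 * (\<integral>\<^sup>+w. (\<lambda>_. 1) w * fibre_int n 1 (F 1) w powre (2/3) * fibre_int n (n + 1) (F (n + 1)) w powre (2/3) \<partial>lborel_PiM (base n 1))"
    by (rule pair_shear_le[OF F 1]) simp_all
  also have "\<dots> = 2 * (total_mass n 1 (F 1) powre (2/3) * total_mass n (n + 1) (F (n + 1)) powre (2/3))"
    using r e by (simp add: m PiM_empty nn_integral_count_space_finite del: One_nat_def)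
  finally show ?thesis
    unfolding prod_partner using n by simp
qed

lemma restrict_base_space: "restrict p (base n j) \<in> space (lborel_PiM (base n j))"
  by (simp add: space_PiM)

text \<open>
  Negative powers of \<^term>\<open>fibre_int n j (F j)\<close> multiply out only where it is finite and nonzero, since
  \<^const>\<open>ennreal_powr\<close> sends \<open>0\<close> to \<open>0\<close> and \<open>\<infinity>\<close> to \<open>\<infinity>\<close> for every exponent.
\<close>

lemma smoothing_estimate:
  fixes n :: nat and F :: "nat \<Rightarrow> (nat \<Rightarrow> real) \<Rightarrow> ennreal"
  assumes n: "n \<ge> 1" and F: "\<And>j. j \<in> {1..2 * n} \<Longrightarrow> F j \<in> borel_measurable (lborel_PiM ({1..2 * n + 1} - {j}))"
    and fin: "\<And>j w. j \<in> {1..2 * n} \<Longrightarrow> w \<in> space (lborel_PiM (base n j)) \<Longrightarrow>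
      fibre_int n j (F j) w \<noteq> 0 \<and> fibre_int n j (F j) w \<noteq> top"
  shows "(\<integral>\<^sup>+p. (\<Prod>j=1..2 * n. F j (shear_proj n j p) powre (2 / (3 * real n)) *
      fibre_int n j (F j) (restrict p (base n j)) powre (- 1 / (6 * real n))) \<partial>lborel_PiM {1..2 * n + 1})
    \<le> 2 * (\<Prod>j=1..2 * n. total_mass n j (F j) powre (1 / (2 * real n)))"
proof -
  have phi_add: "fibre_int n j (F j) w powre (a + b) = fibre_int n j (F j) w powre a * fibre_int n j (F j) w powre b"
    if "j \<in> {1..2 * n}" "w \<in> space (lborel_PiM (base n j))" for j w a b
    using fin[OF that] by (intro ennreal_powr_add) auto
  \<comment> \<open>\<open>Y j\<close> collects the factors of the j-th pair with the exponents
    multiplied by n, so that Hoelder's inequality can be used over the n pairs with equal weights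
    1/n.\<close>
  define Y where "Y j p = F j (shear_proj n j p) powre (2/3) * F (n + j) (shear_proj n (n + j) p) powre (2/3) *
    (fibre_int n j (F j) (restrict p (base n j)) powre (-1/6) * fibre_int n (n + j) (F (n + j)) (restrict p (base n j)) powre (-1/6))" for j p
  have "(\<Prod>j=1..2 * n. F j (shear_proj n j p) powre (2 / (3 * real n)) *
      fibre_int n j (F j) (restrict p (base n j)) powre (- 1 / (6 * real n))) = (\<Prod>j=1..n. Y j p powre (1 / real n))" for p
    unfolding prod_partner
    by (intro prod.cong refl) (simp add: Y_def ennreal_powr_mult ennreal_powr_powr in_range mult_ac)
  then have "(\<integral>\<^sup>+p. (\<Prod>j=1..2 * n. F j (shear_proj n j p) powre (2 / (3 * real n)) *
      fibre_int n j (F j) (restrict p (base n j)) powre (- 1 / (6 * real n))) \<partial>lborel_PiM {1..2 * n + 1})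
    = (\<integral>\<^sup>+p. (\<Prod>j=1..n. Y j p powre (1 / real n)) \<partial>lborel_PiM {1..2 * n + 1})" by simp
  also have "\<dots> \<le> (\<Prod>j=1..n. (\<integral>\<^sup>+p. Y j p \<partial>lborel_PiM {1..2 * n + 1}) powre (1 / real n))"
  proof (rule nn_integral_Holder_prod)
    fix j assume j: "j \<in> {1..n}"
    note r = in_range[OF j]
    have "base n j \<subseteq> {1..2 * n + 1}" using base_props[OF r(1)] by auto
    then show "Y j \<in> borel_measurable (lborel_PiM {1..2 * n + 1})"
      unfolding Y_def
      by (intro borel_measurable_times_ennreal measurable_ennreal_powr
        measurable_shear_proj[OF r(1) F[OF r(1)]] measurable_shear_proj[OF r(2) F[OF r(2)]]
        measurable_fibre_int_restrict[OF r(1) F[OF r(1)]] measurable_fibre_int_restrict[OF r(2) F[OF r(2)], unfolded r(4)])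
  qed (use n in auto)
  also have "\<dots> \<le> (\<Prod>j=1..n. (2 * (total_mass n j (F j) powre (1/2) * total_mass n (n + j) (F (n + j)) powre (1/2))) powre (1 / real n))"
  proof (intro prod_mono_ennreal ennreal_powr_mono)
    fix j assume j: "j \<in> {1..n}"
    note r = in_range[OF j]
    have "(\<integral>\<^sup>+p. Y j p \<partial>lborel_PiM {1..2 * n + 1})
      \<le> 2 * (\<integral>\<^sup>+w. (fibre_int n j (F j) w powre (-1/6) * fibre_int n (n + j) (F (n + j)) w powre (-1/6)) * fibre_int n j (F j) w powre (2/3) * fibre_int n (n + j) (F (n + j)) w powre (2/3) \<partial>lborel_PiM (base n j))"
      unfolding Y_def using measurable_fibre_int_pair[OF F j]
      by (intro pair_shear_le[OF F j] borel_measurable_times_ennreal measurable_ennreal_powr)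
    also have "\<dots> = 2 * (\<integral>\<^sup>+w. fibre_int n j (F j) w powre (1/2) * fibre_int n (n + j) (F (n + j)) w powre (1/2) \<partial>lborel_PiM (base n j))"
    proof (intro arg_cong[where f = "\<lambda>x. 2 * x"] nn_integral_cong)
      fix w assume w: "w \<in> space (lborel_PiM (base n j))"
      \<comment> \<open>The planar bound returns the power 2/3 of each fibre integral. The exponent
        -1/6 is chosen to bring it down to 1/2, as Cauchy-Schwarz needs.\<close>
      have "fibre_int n j (F j) w powre (-1/6 + 2/3) = fibre_int n j (F j) w powre (-1/6) * fibre_int n j (F j) w powre (2/3)"
        "fibre_int n (n + j) (F (n + j)) w powre (-1/6 + 2/3) = fibre_int n (n + j) (F (n + j)) w powre (-1/6) * fibre_int n (n + j) (F (n + j)) w powre (2/3)"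
        by (rule phi_add[OF r(1) w], rule phi_add[OF r(2) w[folded r(4)]])
      then show "fibre_int n j (F j) w powre (-1/6) * fibre_int n (n + j) (F (n + j)) w powre (-1/6) * fibre_int n j (F j) w powre (2/3) * fibre_int n (n + j) (F (n + j)) w powre (2/3)
        = fibre_int n j (F j) w powre (1/2) * fibre_int n (n + j) (F (n + j)) w powre (1/2)"
        by (simp add: mult_ac)
    qed
    also have "\<dots> \<le> 2 * (total_mass n j (F j) powre (1/2) * total_mass n (n + j) (F (n + j)) powre (1/2))"
      by (intro mult_left_mono sqrt_mass_le[OF F j]) simp_all
    finally show "(\<integral>\<^sup>+p. Y j p \<partial>lborel_PiM {1..2 * n + 1}) \<le> 2 * (total_mass n j (F j) powre (1/2) * total_mass n (n + j) (F (n + j)) powre (1/2))" .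
  qed auto
  \<comment> \<open>Each of the n pairs contributes 2^(1/n), so the constant stays 2 for every
    n.\<close>
  also have "\<dots> = 2 * (\<Prod>j=1..2 * n. total_mass n j (F j) powre (1 / (2 * real n)))"
    using n unfolding prod_partner
    by (simp add: ennreal_powr_mult ennreal_powr_powr prod.distrib ennreal_powr_of_nat[symmetric])
  finally show ?thesis .
qed

text \<open>Hoelder's inequality in t with weights 1/(2n) removes the shears and leaves vertical
  integrals. The rest is split by Cauchy-Schwarz into \<open>A\<close>, which factorises pair by
  pair, and \<open>B\<close>, a product of fibre integrals to which Finner's inequality
  applies.\<close>

lemma no_smoothing_estimate:
  fixes n :: nat and F :: "nat \<Rightarrow> (nat \<Rightarrow> real) \<Rightarrow> ennreal"
  assumes n2: "n \<ge> 2" and F: "\<And>j. j \<in> {1..2 * n} \<Longrightarrow> F j \<in> borel_measurable (lborel_PiM ({1..2 * n + 1} - {j}))"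
    and fin: "\<And>j w. j \<in> {1..2 * n} \<Longrightarrow> w \<in> space (lborel_PiM (base n j)) \<Longrightarrow>
      fibre_int n j (F j) w \<noteq> 0 \<and> fibre_int n j (F j) w \<noteq> top"
  shows "(\<integral>\<^sup>+p. (\<Prod>j=1..2 * n. F j (shear_proj n j p) powre (1 / (2 * real n)) *
      fibre_int n j (F j) (restrict p (base n j)) powre (1 / (2 * real n * (2 * real n - 2)))) \<partial>lborel_PiM {1..2 * n + 1})
    \<le> (\<Prod>j=1..2 * n. total_mass n j (F j) powre ((2 * real n - 1) / (2 * real n * (2 * real n - 2))))"
proof -
  have n: "n \<ge> 1" using n2 by simp
  have phi_add: "fibre_int n j (F j) w powre (a + b) = fibre_int n j (F j) w powre a * fibre_int n j (F j) w powre b"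
    if "j \<in> {1..2 * n}" "w \<in> space (lborel_PiM (base n j))" for j w a b
    using fin[OF that] by (intro ennreal_powr_add) auto
  define d :: real where "d = 2 * real n - 2"
  have d: "d > 0" "real (2 * n - 2) = d" using n2 by (simp_all add: d_def of_nat_diff)
  let ?J = "{1..2 * n}"
  define H where "H z = (\<Prod>j\<in>?J. fibre_int n j (F j) (restrict z (base n j)) powre (1 / (2 * real n * d)))" for z
  \<comment> \<open>The power -1/(2n) of the fibre integral is placed here so that integrating a
    pair leaves square roots; \<open>B\<close> compensates for it.\<close>
  define A where "A z = (\<Prod>j\<in>?J. vert_int n (F j) (restrict z (?J - {j})) powre (1 / real n) * fibre_int n j (F j) (restrict z (base n j)) powre (- 1 / (2 * real n)))" for z
  define B where "B z = (\<Prod>j\<in>?J. fibre_int n j (F j) (restrict z (base n j)) powre (1 / d))" for z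
  have m\<phi>: "(\<lambda>z. fibre_int n j (F j) (restrict z (base n j))) \<in> borel_measurable (lborel_PiM ?J)" if "j \<in> ?J" for j
    using base_props(5)[OF that] by (intro measurable_fibre_int_restrict that F)
  note m\<psi> = measurable_vert_int_restrict[OF _ F]
  have ins: "insert (2 * n + 1) (?J - {j}) = {1..2 * n + 1} - {j}" if "j \<in> ?J" for j
    using index_sets(5)[OF that] by simp
  have "(\<integral>\<^sup>+p. (\<Prod>j=1..2 * n. F j (shear_proj n j p) powre (1 / (2 * real n)) *
      fibre_int n j (F j) (restrict p (base n j)) powre (1 / (2 * real n * (2 * real n - 2)))) \<partial>lborel_PiM {1..2 * n + 1})
    = (\<integral>\<^sup>+p. (\<Prod>j\<in>?J. F j (restrict (p(2 * n + 1 := p (2 * n + 1) +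
     (if j \<le> n then 1/2 * p j * p (n + j) else - (1/2 * p (j - n) * p j)))) (insert (2 * n + 1) (?J - {j}))) powre (1 / (2 * real n)))
     * H (restrict p ?J) \<partial>lborel_PiM (insert (2 * n + 1) ?J))"
  proof -
    have top: "insert (2 * n + 1) ?J = {1..2 * n + 1}" by auto
    have restr: "restrict (restrict p ?J) (base n j) = restrict p (base n j)" if "j \<in> ?J" for p :: "nat \<Rightarrow> real" and j
      using base_props(5)[OF that] by (auto simp: restrict_def fun_eq_iff)
    show ?thesis
      unfolding top H_def prod.distrib[symmetric]
      by (intro nn_integral_cong prod.cong refl) (simp only: ins shear_proj_def restr d_def)
  qed
  also have "\<dots> \<le> (\<integral>\<^sup>+z. (\<Prod>j\<in>?J. (\<integral>\<^sup>+t. F j ((restrict z (?J - {j}))(2 * n + 1 := t)) \<partial>lborel) powre (1 / (2 * real n))) * H z \<partial>lborel_PiM ?J)"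
  proof (rule nn_integral_shear_Holder)
    fix j assume j: "j \<in> ?J"
    show "(\<lambda>p. if j \<le> n then 1/2 * p j * p (n + j) else - (1/2 * p (j - n) * p j))
      \<in> borel_measurable (lborel_PiM (insert (2 * n + 1) ?J))"
    proof -
      have [measurable]: "j \<in> insert (2 * n + 1) ?J" "j \<le> n \<Longrightarrow> n + j \<in> insert (2 * n + 1) ?J"
        "\<not> j \<le> n \<Longrightarrow> j - n \<in> insert (2 * n + 1) ?J"
        using j by auto
      have "i \<in> insert (2 * n + 1) ?J \<Longrightarrow> (\<lambda>p. p i) \<in> borel_measurable (lborel_PiM (insert (2 * n + 1) ?J))" for i
        using measurable_component_singleton[of i "insert (2 * n + 1) ?J" "\<lambda>_. lborel :: real measure"] by simp
      then show ?thesis using j by (cases "j \<le> n") (auto intro!: borel_measurable_times simp del: One_nat_def)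
    qed
    show "F j \<in> borel_measurable (lborel_PiM (insert (2 * n + 1) (?J - {j})))"
      using F[OF j] ins[OF j] by simp
    show "(if j \<le> n then 1/2 * (p(2 * n + 1 := u)) j * (p(2 * n + 1 := u)) (n + j)
        else - (1/2 * (p(2 * n + 1 := u)) (j - n) * (p(2 * n + 1 := u)) j))
      = (if j \<le> n then 1/2 * p j * p (n + j) else - (1/2 * p (j - n) * p j))" for p :: "nat \<Rightarrow> real" and u
      using j by auto
  next
    show "H \<in> borel_measurable (lborel_PiM ?J)"
      unfolding H_def by (intro borel_measurable_prod_ennreal measurable_ennreal_powr m\<phi>)
  qed (use n in auto)
  also have "\<dots> = (\<integral>\<^sup>+z. A z powre (1/2) * B z powre (1/2) \<partial>lborel_PiM ?J)"
  proof (rule nn_integral_cong)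
    fix z
    \<comment> \<open>With d = 2n - 2 this splits the exponent in \<open>H\<close> into half the
      exponent in \<open>A\<close> plus half the exponent in \<open>B\<close>.\<close>
    have e: "1 / (2 * real n * d) = - 1 / (4 * real n) + 1 / (2 * d)"
      using d n by (simp add: d_def field_simps)
    have ex: "1 / real n * (1/2) = 1 / (2 * real n)" "- 1 / (2 * real n) * (1/2) = - 1 / (4 * real n)"
      "1 / d * (1/2) = 1 / (2 * d)" by simp_all
    have Hz: "H z = (\<Prod>j\<in>?J. fibre_int n j (F j) (restrict z (base n j)) powre (- 1 / (4 * real n)) * fibre_int n j (F j) (restrict z (base n j)) powre (1 / (2 * d)))"
      unfolding H_def e by (intro prod.cong refl phi_add restrict_base_space)
    show "(\<Prod>j\<in>?J. (\<integral>\<^sup>+t. F j ((restrict z (?J - {j}))(2 * n + 1 := t)) \<partial>lborel) powre (1 / (2 * real n))) * H z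
        = A z powre (1/2) * B z powre (1/2)"
      by (simp only: Hz A_def B_def vert_int_def ennreal_powr_prod ennreal_powr_mult ennreal_powr_powr prod.distrib ex mult.assoc)
  qed
  also have "\<dots> \<le> (\<integral>\<^sup>+z. A z \<partial>lborel_PiM ?J) powre (1/2) * (\<integral>\<^sup>+z. B z \<partial>lborel_PiM ?J) powre (1/2)"
    unfolding A_def B_def
    by (intro nn_integral_Holder borel_measurable_prod_ennreal borel_measurable_times_ennreal measurable_ennreal_powr m\<phi> m\<psi>) auto
  also have "\<dots> \<le> (\<Prod>j\<in>?J. total_mass n j (F j) powre (1 / (2 * real n))) powre (1/2) * (\<Prod>j\<in>?J. total_mass n j (F j) powre (1 / d)) powre (1/2)"
  proof (intro mult_mono ennreal_powr_mono)
    \<comment> \<open>Integrating the two vertical integrals over their partner variables gives both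
      fibre integrals to the power 1; with the factors of power -1/2 each is left with power
      1/2.\<close>
    define Y where "Y j z = vert_int n (F j) (restrict z (?J - {j})) * vert_int n (F (n + j)) (restrict z (?J - {n + j})) *
      (fibre_int n j (F j) (restrict z (base n j)) powre (- 1/2) * fibre_int n (n + j) (F (n + j)) (restrict z (base n j)) powre (- 1/2))" for j z
    have "A z = (\<Prod>j=1..n. Y j z powre (1 / real n))" for z
      unfolding A_def prod_partner
      by (intro prod.cong refl) (simp add: Y_def ennreal_powr_mult ennreal_powr_powr in_range mult_ac)
    then have "(\<integral>\<^sup>+z. A z \<partial>lborel_PiM ?J) = (\<integral>\<^sup>+z. (\<Prod>j=1..n. Y j z powre (1 / real n)) \<partial>lborel_PiM ?J)" by simp
    also have "\<dots> \<le> (\<Prod>j=1..n. (\<integral>\<^sup>+z. Y j z \<partial>lborel_PiM ?J) powre (1 / real n))"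
    proof (rule nn_integral_Holder_prod)
      fix j assume j: "j \<in> {1..n}"
      note r = in_range[OF j]
      show "Y j \<in> borel_measurable (lborel_PiM ?J)"
        unfolding Y_def
        by (intro borel_measurable_times_ennreal measurable_ennreal_powr
          m\<psi>[OF r(1) r(1)] m\<psi>[OF r(2) r(2)] m\<phi>[OF r(1)] m\<phi>[OF r(2), unfolded r(4)])
    qed (use n in auto)
    also have "\<dots> \<le> (\<Prod>j=1..n. (total_mass n j (F j) powre (1/2) * total_mass n (n + j) (F (n + j)) powre (1/2)) powre (1 / real n))"
    proof (intro prod_mono_ennreal ennreal_powr_mono)
      fix j assume j: "j \<in> {1..n}"
      note r = in_range[OF j]
      have p: "partner n (n + j) = j" using j by (simp add: partner_def)
      have sets: "?J = insert j (insert (n + j) (base n j))" "?J - {j} = insert (n + j) (base n j)"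
        "?J - {n + j} = insert j (base n j)"
        by (rule index_sets(1)[OF r(1), unfolded r(3)], rule index_sets(2)[OF r(1), unfolded r(3)],
          rule index_sets(2)[OF r(2), unfolded r(4) p])
      have "(\<integral>\<^sup>+z. Y j z \<partial>lborel_PiM ?J) = (\<integral>\<^sup>+w. (fibre_int n j (F j) w powre (- 1/2) * fibre_int n (n + j) (F (n + j)) w powre (- 1/2)) * fibre_int n j (F j) w * fibre_int n (n + j) (F (n + j)) w \<partial>lborel_PiM (base n j))"
      proof -
        have m: "vert_int n (F j) \<in> borel_measurable (lborel_PiM (insert (n + j) (base n j)))"
          "vert_int n (F (n + j)) \<in> borel_measurable (lborel_PiM (insert j (base n j)))"
          using measurable_vert_int[OF r(1) F[OF r(1)]] measurable_vert_int[OF r(2) F[OF r(2)]] unfolding sets(2,3) .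
        have mH: "(\<lambda>w. fibre_int n j (F j) w powre (- 1/2) * fibre_int n (n + j) (F (n + j)) w powre (- 1/2))
            \<in> borel_measurable (lborel_PiM (base n j))"
          by (intro borel_measurable_times_ennreal measurable_ennreal_powr measurable_fibre_int_pair[OF F j])
        have b: "finite (base n j)" "j \<notin> base n j" "n + j \<notin> base n j" "j \<noteq> n + j"
          using base_props(1-3)[OF r(1)] r(3) n by simp_all
        have marg: "(\<integral>\<^sup>+y. vert_int n (F j) (w(n + j := y)) \<partial>lborel) = fibre_int n j (F j) w"
          "(\<integral>\<^sup>+y. vert_int n (F (n + j)) (w(j := y)) \<partial>lborel) = fibre_int n (n + j) (F (n + j)) w" for w
          by (simp_all only: fibre_int_def r(3) p)
        show ?thesis
          unfolding Y_def sets(2,3) unfolding sets(1) by (rule nn_integral_product_pair[OF b m mH, unfolded marg])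
      qed
      also have "\<dots> = (\<integral>\<^sup>+w. fibre_int n j (F j) w powre (1/2) * fibre_int n (n + j) (F (n + j)) w powre (1/2) \<partial>lborel_PiM (base n j))"
      proof (rule nn_integral_cong)
        fix w assume w: "w \<in> space (lborel_PiM (base n j))"
        have "fibre_int n j (F j) w powre (- 1/2 + 1) = fibre_int n j (F j) w powre (- 1/2) * fibre_int n j (F j) w powre 1"
          "fibre_int n (n + j) (F (n + j)) w powre (- 1/2 + 1) = fibre_int n (n + j) (F (n + j)) w powre (- 1/2) * fibre_int n (n + j) (F (n + j)) w powre 1"
          by (rule phi_add[OF r(1) w], rule phi_add[OF r(2) w[folded r(4)]])
        then show "fibre_int n j (F j) w powre (- 1/2) * fibre_int n (n + j) (F (n + j)) w powre (- 1/2) * fibre_int n j (F j) w * fibre_int n (n + j) (F (n + j)) w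
          = fibre_int n j (F j) w powre (1/2) * fibre_int n (n + j) (F (n + j)) w powre (1/2)"
          by (simp add: mult_ac)
      qed
      also have "\<dots> \<le> total_mass n j (F j) powre (1/2) * total_mass n (n + j) (F (n + j)) powre (1/2)"
        by (rule sqrt_mass_le[OF F j])
      finally show "(\<integral>\<^sup>+z. Y j z \<partial>lborel_PiM ?J) \<le> total_mass n j (F j) powre (1/2) * total_mass n (n + j) (F (n + j)) powre (1/2)" .
    qed auto
    also have "\<dots> = (\<Prod>j\<in>?J. total_mass n j (F j) powre (1 / (2 * real n)))"
      unfolding prod_partner by (simp add: ennreal_powr_mult ennreal_powr_powr)
    finally show "(\<integral>\<^sup>+z. A z \<partial>lborel_PiM ?J) \<le> (\<Prod>j\<in>?J. total_mass n j (F j) powre (1 / (2 * real n)))" .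
  next
    have "(\<integral>\<^sup>+z. B z \<partial>lborel_PiM ?J) \<le> (\<Prod>j\<in>?J. (\<integral>\<^sup>+w. fibre_int n j (F j) w \<partial>lborel_PiM (base n j)) powre (1 / d))"
      unfolding B_def
    proof (rule product_sigma_finite.nn_integral_Finner[OF product_sigma_finite_lborel])
      fix k assume k: "k \<in> ?J"
      \<comment> \<open>Membership is symmetric: k lies in the base of j exactly when j lies in the
        base of k. Thus every coordinate is covered 2n - 2 times, and weights 1/(2n - 2) satisfy
        Finner's condition.\<close>
      have "{j \<in> ?J. k \<in> base n j} = base n k"
        using k partner[OF k] partner(3) by (auto simp: base_def)
      then show "(\<Sum>j\<in>{j \<in> ?J. k \<in> base n j}. 1 / d) = 1"
        using base_props(6)[OF k] d by simp
    next
      fix j assume j: "j \<in> ?J"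
      show "base n j \<subseteq> ?J" by (rule base_props(5)[OF j])
      show "fibre_int n j (F j) \<in> borel_measurable (lborel_PiM (base n j))"
        by (rule measurable_fibre_int[OF j F[OF j]])
    qed (use d in simp_all)
    also have "\<dots> = (\<Prod>j\<in>?J. total_mass n j (F j) powre (1 / d))"
      by (intro prod.cong refl) (simp only: nn_integral_fibre_int F)
    finally show "(\<integral>\<^sup>+z. B z \<partial>lborel_PiM ?J) \<le> (\<Prod>j\<in>?J. total_mass n j (F j) powre (1 / d))" .
  qed auto
  also have "\<dots> = (\<Prod>j\<in>?J. total_mass n j (F j) powre ((2 * real n - 1) / (2 * real n * (2 * real n - 2))))"
  proof -
    have "(2 * real n - 1) / (2 * real n * (2 * real n - 2)) = 1 / (2 * real n) * (1/2) + 1 / d * (1/2)"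
      using d n by (simp add: d_def field_simps)
    then show ?thesis
      using d n by (simp only: ennreal_powr_prod ennreal_powr_powr)
        (simp add: prod.distrib[symmetric] ennreal_powr_add)
  qed
  finally show ?thesis .
qed

section \<open>Combining the two estimates by Hoelder's inequality\<close>

lemma vertical_inequality_powers:
  fixes n :: nat and F :: "nat \<Rightarrow> (nat \<Rightarrow> real) \<Rightarrow> ennreal"
  assumes n: "n \<ge> 1" and F: "\<And>j. j \<in> {1..2 * n} \<Longrightarrow> F j \<in> borel_measurable (lborel_PiM ({1..2 * n + 1} - {j}))"
    and fin: "\<And>j w. j \<in> {1..2 * n} \<Longrightarrow> w \<in> space (lborel_PiM (base n j)) \<Longrightarrow>
      fibre_int n j (F j) w \<noteq> 0 \<and> fibre_int n j (F j) w \<noteq> top"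
  shows "(\<integral>\<^sup>+p. (\<Prod>j=1..2 * n. F j (shear_proj n j p) powre ((real n + 1) / (real n * (2 * real n + 1)))) \<partial>lborel_PiM {1..2 * n + 1})
    \<le> 2 * (\<Prod>j=1..2 * n. total_mass n j (F j) powre ((real n + 1) / (real n * (2 * real n + 1))))"
proof (cases "n = 1")
  case True
  then have "(real n + 1) / (real n * (2 * real n + 1)) = 2 / 3" by simp
  then show ?thesis using vertical_inequality_one[OF F True] by (simp only:)
next
  case False
  with n have n2: "n \<ge> 2" by simp
  \<comment> \<open>The solution of a + b = 1 together with the cancellation of the fibre integrals,
    -a/(6n) + b/(2n(2n - 2)) = 0. The exponent of each \<open>F j\<close> then becomes 1/p.\<close>
  define a b :: real where "a = 3 / (2 * real n + 1)" and "b = (2 * real n - 2) / (2 * real n + 1)"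
  have ab: "a > 0" "b > 0" "a + b = 1" "a \<le> 1" using n2 by (auto simp: a_def b_def divide_simps) (auto simp: algebra_simps)
  let ?A = "\<lambda>j p. F j (shear_proj n j p) powre (2 / (3 * real n)) * fibre_int n j (F j) (restrict p (base n j)) powre (- 1 / (6 * real n))"
  let ?B = "\<lambda>j p. F j (shear_proj n j p) powre (1 / (2 * real n)) * fibre_int n j (F j) (restrict p (base n j)) powre (1 / (2 * real n * (2 * real n - 2)))"
  have split: "F j (shear_proj n j p) powre ((real n + 1) / (real n * (2 * real n + 1))) = ?A j p powre a * ?B j p powre b"
    if j: "j \<in> {1..2 * n}" for j p
  proof -
    let ?f = "F j (shear_proj n j p)" and ?g = "fibre_int n j (F j) (restrict p (base n j))"
    have g: "?g \<noteq> 0" "?g \<noteq> top" using fin[OF j restrict_base_space] by auto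
    have 1: "2 / (3 * real n) * a + 1 / (2 * real n) * b = (real n + 1) / (real n * (2 * real n + 1))"
      using n2 unfolding a_def b_def by (simp add: divide_simps; simp add: algebra_simps)
    have 2: "- 1 / (6 * real n) * a + 1 / (2 * real n * (2 * real n - 2)) * b = 0"
      using n2 unfolding a_def b_def by (simp add: divide_simps; simp add: algebra_simps)
    have "?A j p powre a * ?B j p powre b = (?f powre (2 / (3 * real n) * a) * ?f powre (1 / (2 * real n) * b)) *
      (?g powre (- 1 / (6 * real n) * a) * ?g powre (1 / (2 * real n * (2 * real n - 2)) * b))"
      by (simp only: ennreal_powr_mult ennreal_powr_powr mult_ac)
    also have "?f powre (2 / (3 * real n) * a) * ?f powre (1 / (2 * real n) * b) = ?f powre ((real n + 1) / (real n * (2 * real n + 1)))"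
      unfolding 1[symmetric] using ab by (intro ennreal_powr_add[symmetric]) auto
    also have "?g powre (- 1 / (6 * real n) * a) * ?g powre (1 / (2 * real n * (2 * real n - 2)) * b) = ?g powre 0"
      unfolding 2[symmetric] using g by (intro ennreal_powr_add[symmetric]) auto
    \<comment> \<open>A zeroth power equals 1 only away from 0 and \<infinity>, where
      \<open>ennreal_powr\<close> returns its argument.\<close>
    also have "\<dots> = 1" using g by (cases ?g) (auto simp: ennreal_powr_ennreal)
    finally show ?thesis by (simp only: mult_1_right)
  qed
  have "(\<integral>\<^sup>+p. (\<Prod>j=1..2 * n. F j (shear_proj n j p) powre ((real n + 1) / (real n * (2 * real n + 1)))) \<partial>lborel_PiM {1..2 * n + 1})
    = (\<integral>\<^sup>+p. (\<Prod>j=1..2 * n. ?A j p) powre a * (\<Prod>j=1..2 * n. ?B j p) powre b \<partial>lborel_PiM {1..2 * n + 1})"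
    unfolding ennreal_powr_prod prod.distrib[symmetric] by (intro nn_integral_cong prod.cong refl split)
  also have "\<dots> \<le> (\<integral>\<^sup>+p. (\<Prod>j=1..2 * n. ?A j p) \<partial>lborel_PiM {1..2 * n + 1}) powre a *
      (\<integral>\<^sup>+p. (\<Prod>j=1..2 * n. ?B j p) \<partial>lborel_PiM {1..2 * n + 1}) powre b"
  proof (rule nn_integral_Holder)
    have sub: "base n j \<subseteq> {1..2 * n + 1}" if "j \<in> {1..2 * n}" for j
      using base_props(5)[OF that] by auto
    show "(\<lambda>p. \<Prod>j=1..2 * n. ?A j p) \<in> borel_measurable (lborel_PiM {1..2 * n + 1})"
      "(\<lambda>p. \<Prod>j=1..2 * n. ?B j p) \<in> borel_measurable (lborel_PiM {1..2 * n + 1})"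
      by (intro borel_measurable_prod_ennreal borel_measurable_times_ennreal
        measurable_ennreal_powr measurable_shear_proj measurable_fibre_int_restrict F sub; assumption)+
  qed (use ab in auto)
  also have "\<dots> \<le> (2 * (\<Prod>j=1..2 * n. total_mass n j (F j) powre (1 / (2 * real n)))) powre a *
      (\<Prod>j=1..2 * n. total_mass n j (F j) powre ((2 * real n - 1) / (2 * real n * (2 * real n - 2)))) powre b"
    using ab by (intro mult_mono ennreal_powr_mono smoothing_estimate no_smoothing_estimate n n2 F fin) auto
  also have "\<dots> = 2 powre a * (\<Prod>j=1..2 * n. total_mass n j (F j) powre ((real n + 1) / (real n * (2 * real n + 1))))"
  proof -
    have "(real n + 1) / (real n * (2 * real n + 1)) = 1 / (2 * real n) * a + (2 * real n - 1) / (2 * real n * (2 * real n - 2)) * b"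
      using n2 unfolding a_def b_def by (simp add: divide_simps; simp add: algebra_simps)
    then have "x powre ((real n + 1) / (real n * (2 * real n + 1))) = x powre (1 / (2 * real n) * a) * x powre ((2 * real n - 1) / (2 * real n * (2 * real n - 2)) * b)" for x
      using ab n2 by (simp only:) (intro ennreal_powr_add, auto)
    then show ?thesis
      by (simp only: ennreal_powr_mult ennreal_powr_prod ennreal_powr_powr prod.distrib mult.assoc)
  qed
  also have "\<dots> \<le> 2 * (\<Prod>j=1..2 * n. total_mass n j (F j) powre ((real n + 1) / (real n * (2 * real n + 1))))"
  proof (intro mult_right_mono)
    \<comment> \<open>Only the estimate with smoothing carries a constant, which enters with the
      power a \<le> 1.\<close>
    have "2 powre a = ennreal (2 powr a)" using ennreal_powr_ennreal[of 2 a] by simp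
    also have "\<dots> \<le> ennreal 2" using powr_mono[of a 1 2] ab by (intro ennreal_leI) simp
    finally show "2 powre a \<le> 2" by simp
  qed auto
  finally show ?thesis .
qed

section \<open>Truncation and Lebesgue measurability\<close>

lemma fibre_int_mono:
  assumes "\<And>q. f q \<le> g q"
  shows "fibre_int n j f w \<le> fibre_int n j g w"
  unfolding fibre_int_def vert_int_def by (intro nn_integral_mono assms)

lemma fibre_int_cmult:
  assumes j: "j \<in> {1..2 * n}" and f: "f \<in> borel_measurable (lborel_PiM ({1..2 * n + 1} - {j}))"
    and w: "w \<in> space (lborel_PiM (base n j))"
  shows "fibre_int n j (\<lambda>q. c * f q) w = c * fibre_int n j f w"
proof -
  have f': "f \<in> borel_measurable (lborel_PiM (insert (2 * n + 1) (insert (partner n j) (base n j))))"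
    using f unfolding index_sets(3)[OF j] .
  have m: "(\<lambda>z. f (w(partner n j := fst z, 2 * n + 1 := snd z))) \<in> borel_measurable (borel \<Otimes>\<^sub>M borel)"
    using w by (intro measurable_compose[OF _ f'] measurable_lborel_PiM_upd) auto
  have [measurable]: "(\<lambda>(y, t). f (w(partner n j := y, 2 * n + 1 := t))) \<in> borel_measurable (borel \<Otimes>\<^sub>M borel)"
    using m by (simp add: case_prod_unfold)
  have "(\<integral>\<^sup>+t. c * f (w(partner n j := y, 2 * n + 1 := t)) \<partial>lborel) = c * (\<integral>\<^sup>+t. f (w(partner n j := y, 2 * n + 1 := t)) \<partial>lborel)" for y
    by (rule nn_integral_cmult) measurable
  then show ?thesis
    unfolding fibre_int_def vert_int_def by (simp only:) (rule nn_integral_cmult, measurable)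
qed

text \<open>With \<open>g\<close> positive and integrable on the line, this gives an integrable
  comparison function whose fibre integrals can be computed at every point.\<close>

definition prod_weight :: "(real \<Rightarrow> ennreal) \<Rightarrow> 'i set \<Rightarrow> ('i \<Rightarrow> real) \<Rightarrow> ennreal" where
  "prod_weight g I q = (\<Prod>i\<in>I. g (q i))"

text \<open>The square comes from the two variables integrated out, the partner coordinate and t.
  The formula holds at every w, so fibre integrals of the weight are positive and finite everywhere
  and not just almost everywhere.\<close>

lemma fibre_int_prod_weight:
  assumes j: "j \<in> {1..2 * n}" and [measurable]: "g \<in> borel_measurable borel"
  shows "fibre_int n j (prod_weight g ({1..2 * n + 1} - {j})) w = (\<integral>\<^sup>+x. g x \<partial>lborel)\<^sup>2 * prod_weight g (base n j) w"
proof -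
  have "prod_weight g ({1..2 * n + 1} - {j}) (w(partner n j := y, 2 * n + 1 := t)) = g y * g t * prod_weight g (base n j) w" for y t
  proof -
    have "(\<Prod>i\<in>base n j. g ((w(partner n j := y, 2 * n + 1 := t)) i)) = prod_weight g (base n j) w"
      unfolding prod_weight_def using base_props[OF j] by (intro prod.cong) auto
    moreover have "partner n j \<noteq> 2 * n + 1" using partner[OF j] by auto
    ultimately show ?thesis
      using base_props[OF j] unfolding prod_weight_def index_sets(3)[OF j] by (simp add: mult_ac)
  qed
  then show ?thesis
    by (simp add: fibre_int_def vert_int_def nn_integral_cmult nn_integral_multc power2_eq_square mult_ac)
qed

theorem theorem1p8:
  fixes n :: nat
  assumes "n \<ge> 1"
  shows "\<exists>C::real. C > 0 \<and>
    (\<forall>f :: nat \<Rightarrow> (nat \<Rightarrow> real) \<Rightarrow> ennreal.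
      (\<forall>j\<in>{1..2 * n}. f j \<in> borel_measurable (lebesgue_Rn (2 * n))) \<longrightarrow>
      (\<integral>\<^sup>+ p. (\<Prod>j = 1..2 * n. f j (vert_proj n j p)) \<partial>lebesgue_Rn (2 * n + 1))
        \<le> ennreal C *
          (\<Prod>j = 1..2 * n.
             Lp_norm (real n * (2 * real n + 1) / (real n + 1)) (lebesgue_Rn (2 * n)) (f j)))"
proof -
  note n = assms
  define p where "p = real n * (2 * real n + 1) / (real n + 1)"
  have vertical: "(\<integral>\<^sup>+x. (\<Prod>j=1..2 * n. f j (shear_proj n j x)) \<partial>lborel_PiM {1..2 * n + 1})
      \<le> 2 * (\<Prod>j=1..2 * n. (\<integral>\<^sup>+q. f j q powre p \<partial>lborel_PiM ({1..2 * n + 1} - {j})) powre (1 / p))"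
    if f: "\<And>j. j \<in> {1..2 * n} \<Longrightarrow> f j \<in> borel_measurable (lborel_PiM ({1..2 * n + 1} - {j}))"
    for f :: "nat \<Rightarrow> (nat \<Rightarrow> real) \<Rightarrow> ennreal"
  proof -
    have p: "p > 0" "1 / p = (real n + 1) / (real n * (2 * real n + 1))" using n by (auto simp: p_def)
    obtain g :: "real \<Rightarrow> ennreal" where g [measurable]: "g \<in> borel_measurable lborel"
      and g_fin: "(\<integral>\<^sup>+x. g x \<partial>lborel) \<noteq> \<infinity>" and g_pos: "\<And>x. 0 < g x \<and> g x < \<infinity>"
      using sigma_finite_measure.Ex_finite_integrable_function[OF sigma_finite_lborel] by auto
    define c where "c = (\<integral>\<^sup>+x. g x \<partial>lborel)"
    have c: "c \<noteq> 0" "c \<noteq> top"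
    proof
      assume "c = 0"
      then have "AE x in lborel. g x = 0" unfolding c_def by (subst (asm) nn_integral_0_iff_AE) auto
      \<comment> \<open>\<open>g\<close> vanishes nowhere, so the assumption makes an impossible
        condition hold almost everywhere; testing it on the unit interval, of measure 1, gives the
        contradiction.\<close>
      then have "AE x in lborel. indicator {0..1::real} x = (0 :: ennreal)"
        by eventually_elim (use g_pos in \<open>metis less_irrefl\<close>)
      then have "(\<integral>\<^sup>+x. indicator {0..1::real} x \<partial>lborel) = 0"
        by (subst nn_integral_0_iff_AE) auto
      then show False by simp
    qed (use g_fin in \<open>simp add: c_def\<close>)
    let ?D = "\<lambda>j. {1..2 * n + 1} - {j}"
    define \<Gamma> where "\<Gamma> j = prod_weight g (?D j)" for j
    have \<Gamma>_pos: "\<Gamma> j q \<noteq> 0" "\<Gamma> j q \<noteq> top" for j q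
      using g_pos by (auto simp: \<Gamma>_def prod_weight_def ennreal_prod_eq_top prod_zero_iff less_imp_neq) (metis less_irrefl)+
    have m\<Gamma> [measurable]: "\<Gamma> j \<in> borel_measurable (lborel_PiM (?D j))" for j
      unfolding \<Gamma>_def prod_weight_def by measurable
    have int\<Gamma>: "(\<integral>\<^sup>+q. \<Gamma> j q \<partial>lborel_PiM (?D j)) = c ^ card (?D j)" for j
      unfolding \<Gamma>_def prod_weight_def c_def by (subst product_sigma_finite.product_nn_integral_prod[OF product_sigma_finite_lborel]) auto
    have fib\<Gamma>: "fibre_int n j (\<Gamma> j) w \<noteq> 0 \<and> fibre_int n j (\<Gamma> j) w \<noteq> top" if "j \<in> {1..2 * n}" for j w
    proof -
      have "prod_weight g (base n j) w \<noteq> 0 \<and> prod_weight g (base n j) w \<noteq> top"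
        using g_pos base_props[OF that] by (auto simp: prod_weight_def ennreal_prod_eq_top) (metis less_irrefl)+
      then show ?thesis using c unfolding \<Gamma>_def
        by (subst (1 2) fibre_int_prod_weight[OF that]) (auto simp: c_def[symmetric] ennreal_mult_eq_top_iff power_eq_top_ennreal)
    qed
    \<comment> \<open>Truncating by multiples of \<open>\<Gamma>\<close> bounds the fibre integrals from above; adding \<open>e * \<Gamma>\<close> below keeps them positive.\<close>
    define fk where "fk k j q = min (f j q) (of_nat k * \<Gamma> j q powre (1 / p))" for k :: nat and j q
    have mfk: "fk k j \<in> borel_measurable (lborel_PiM (?D j))" if "j \<in> {1..2 * n}" for k j
      unfolding fk_def using f[OF that] by measurable
    have fk_le: "fk k j q powre p \<le> of_nat k powre p * \<Gamma> j q" for k j q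
    proof -
      have "fk k j q powre p \<le> (of_nat k * \<Gamma> j q powre (1 / p)) powre p"
        using p unfolding fk_def by (intro ennreal_powr_mono) auto
      then show ?thesis using p(1) by (simp add: ennreal_powr_mult ennreal_powr_powr)
    qed
    let ?I = "\<lambda>h. \<integral>\<^sup>+x. (\<Prod>j=1..2 * n. h j (shear_proj n j x)) \<partial>lborel_PiM {1..2 * n + 1}"
    let ?m = "\<lambda>h j. (\<integral>\<^sup>+q. h j q powre p \<partial>lborel_PiM (?D j))"
    have trunc: "?I (fk k) \<le> 2 * (\<Prod>j=1..2 * n. ?m (fk k) j powre (1 / p))" for k
    proof -
      have step: "?I (fk k) \<le> 2 * (\<Prod>j=1..2 * n. (?m (fk k) j + ennreal e * c ^ card (?D j)) powre (1 / p))" if e: "e > 0" for e :: real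
      proof -
        define F where "F j q = fk k j q powre p + ennreal e * \<Gamma> j q" for j q
        have mF: "F j \<in> borel_measurable (lborel_PiM (?D j))" if "j \<in> {1..2 * n}" for j
          unfolding F_def using mfk[OF that] by measurable
        have fin: "fibre_int n j (F j) w \<noteq> 0 \<and> fibre_int n j (F j) w \<noteq> top"
          if j: "j \<in> {1..2 * n}" and w: "w \<in> space (lborel_PiM (base n j))" for j w
        proof -
          have "ennreal e * fibre_int n j (\<Gamma> j) w \<le> fibre_int n j (F j) w"
            unfolding fibre_int_cmult[OF j m\<Gamma> w, symmetric] by (intro fibre_int_mono) (simp add: F_def)
          moreover have "fibre_int n j (F j) w \<le> (of_nat k powre p + ennreal e) * fibre_int n j (\<Gamma> j) w"
            unfolding fibre_int_cmult[OF j m\<Gamma> w, symmetric]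
            by (intro fibre_int_mono) (simp add: F_def distrib_right add_mono fk_le)
          moreover have "(of_nat k powre p + ennreal e) * fibre_int n j (\<Gamma> j) w \<noteq> top"
            using fib\<Gamma>[OF j] by (simp add: ennreal_mult_eq_top_iff)
          ultimately show "fibre_int n j (F j) w \<noteq> 0 \<and> fibre_int n j (F j) w \<noteq> top"
            using fib\<Gamma>[OF j, of w] e by (auto simp: top_unique)
        qed
        have "?I (fk k) \<le> ?I (\<lambda>j q. F j q powre (1 / p))"
        proof (intro nn_integral_mono prod_mono_ennreal)
          fix x j
          have "(fk k j (shear_proj n j x) powre p) powre (1 / p) \<le> F j (shear_proj n j x) powre (1 / p)"
            using p by (intro ennreal_powr_mono) (auto simp: F_def)
          then show "fk k j (shear_proj n j x) \<le> F j (shear_proj n j x) powre (1 / p)"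
            using p(1) by (simp add: ennreal_powr_powr)
        qed
        also have "\<dots> \<le> 2 * (\<Prod>j=1..2 * n. (\<integral>\<^sup>+q. F j q \<partial>lborel_PiM (?D j)) powre (1 / p))"
          using vertical_inequality_powers[OF n mF fin] unfolding p(2) .
        also have "\<dots> = 2 * (\<Prod>j=1..2 * n. (?m (fk k) j + ennreal e * c ^ card (?D j)) powre (1 / p))"
        proof (intro arg_cong[where f = "\<lambda>x. 2 * x"] prod.cong refl arg_cong[where f = "\<lambda>x. x powre (1 / p)"])
          fix j assume "j \<in> {1..2 * n}"
          then have [measurable]: "fk k j \<in> borel_measurable (lborel_PiM (?D j))" by (rule mfk)
          show "(\<integral>\<^sup>+q. F j q \<partial>lborel_PiM (?D j)) = ?m (fk k) j + ennreal e * c ^ card (?D j)"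
            unfolding F_def int\<Gamma>[symmetric] by (subst nn_integral_add) (auto simp: nn_integral_cmult simp del: One_nat_def)
        qed
        finally show ?thesis .
      qed
      \<comment> \<open>For fixed k all masses are finite, being at most k^p times the mass of the
        weight, so the limit e \<rightarrow> 0 can be taken among real numbers.\<close>
      define r where "r j = enn2real (?m (fk k) j)" for j
      define s where "s j = enn2real (c ^ card (?D j))" for j
      have s: "c ^ card (?D j) = ennreal (s j)" for j
        using c by (simp add: s_def less_top power_less_top_ennreal)
      have r: "?m (fk k) j = ennreal (r j)" for j
      proof -
        have "?m (fk k) j \<le> (\<integral>\<^sup>+q. of_nat k powre p * \<Gamma> j q \<partial>lborel_PiM (?D j))"
          by (intro nn_integral_mono fk_le)
        also have "\<dots> = of_nat k powre p * ennreal (s j)"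
          unfolding s[symmetric] int\<Gamma>[symmetric] by (rule nn_integral_cmult) measurable
        also have "\<dots> < top" unfolding less_top[symmetric] by (simp add: ennreal_mult_eq_top_iff)
        finally show ?thesis by (simp add: r_def)
      qed
      have nonneg: "r j \<ge> 0" "s j \<ge> 0" for j by (simp_all add: r_def s_def)
      have "?I (fk k) \<le> ennreal (2 * (\<Prod>j=1..2 * n. (r j + e * s j) powr (1 / p)))" if e: "e > 0" for e
      proof -
        have "(\<Prod>j=1..2 * n. (?m (fk k) j + ennreal e * c ^ card (?D j)) powre (1 / p)) = (\<Prod>j=1..2 * n. ennreal ((r j + e * s j) powr (1 / p)))"
          using nonneg e by (intro prod.cong refl)
            (simp only: r s ennreal_mult[symmetric] ennreal_plus[symmetric] ennreal_powr_ennreal add_nonneg_nonneg mult_nonneg_nonneg less_imp_le)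
        then have "2 * (\<Prod>j=1..2 * n. (?m (fk k) j + ennreal e * c ^ card (?D j)) powre (1 / p))
            = ennreal (2 * (\<Prod>j=1..2 * n. (r j + e * s j) powr (1 / p)))"
          by (simp add: prod_ennreal ennreal_mult prod_nonneg)
        then show ?thesis using step[OF e] by (simp only:)
      qed
      then have "?I (fk k) \<le> ennreal (2 * (\<Prod>j=1..2 * n. (r j + inverse (real (Suc i)) * s j) powr (1 / p)))" for i
        by simp
      \<comment> \<open>The limit is taken along e = 1/(i + 1). As 1/p > 0, the power is continuous
        from the right at 0, so a vanishing \<open>r j\<close> is allowed.\<close>
      moreover have "(\<lambda>i. ennreal (2 * (\<Prod>j=1..2 * n. (r j + inverse (real (Suc i)) * s j) powr (1 / p))))
          \<longlonglongrightarrow> ennreal (2 * (\<Prod>j=1..2 * n. (r j + 0 * s j) powr (1 / p)))"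
        using nonneg p
        by (intro tendsto_ennrealI tendsto_mult tendsto_const tendsto_prod tendsto_powr' tendsto_add LIMSEQ_inverse_real_of_nat) auto
      ultimately have "?I (fk k) \<le> ennreal (2 * (\<Prod>j=1..2 * n. (r j + 0 * s j) powr (1 / p)))"
        by (intro LIMSEQ_le_const) auto
      also have "\<dots> = 2 * (\<Prod>j=1..2 * n. ?m (fk k) j powre (1 / p))"
      proof -
        have "(\<Prod>j=1..2 * n. ?m (fk k) j powre (1 / p)) = ennreal (\<Prod>j=1..2 * n. (r j + 0 * s j) powr (1 / p))"
          unfolding r by (subst prod_ennreal[symmetric]) (auto simp: ennreal_powr_ennreal nonneg)
        then show ?thesis by (simp only:) (subst ennreal_mult, auto intro!: prod_nonneg)
      qed
      finally show ?thesis .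
    qed
    have inc: "incseq (\<lambda>k. fk k j q)" for j q
      by (auto simp: incseq_def fk_def min_le_iff_disj intro!: min.mono mult_right_mono)
    \<comment> \<open>The truncations increase to \<open>f j\<close> pointwise because the weight
      vanishes nowhere; monotone convergence transfers the bound to \<open>f\<close>.\<close>
    have "?I f = (\<integral>\<^sup>+x. (SUP k. \<Prod>j=1..2 * n. fk k j (shear_proj n j x)) \<partial>lborel_PiM {1..2 * n + 1})"
    proof (intro nn_integral_cong)
      fix x
      have "(SUP k. fk k j (shear_proj n j x)) = f j (shear_proj n j x)" for j
        unfolding fk_def using \<Gamma>_pos by (intro ennreal_min_SUP_multiple) simp
      then show "(\<Prod>j=1..2 * n. f j (shear_proj n j x)) = (SUP k. \<Prod>j=1..2 * n. fk k j (shear_proj n j x))"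
        using inc by (subst SUP_prod_incseq_ennreal) auto
    qed
    also have "\<dots> = (SUP k. ?I (fk k))"
      using inc mfk by (intro nn_integral_monotone_convergence_SUP borel_measurable_prod_ennreal measurable_shear_proj)
        (auto simp: incseq_def le_fun_def intro!: prod_mono_ennreal)
    also have "\<dots> \<le> 2 * (\<Prod>j=1..2 * n. ?m f j powre (1 / p))"
    proof (rule SUP_least)
      fix k
      have "2 * (\<Prod>j=1..2 * n. ?m (fk k) j powre (1 / p)) \<le> 2 * (\<Prod>j=1..2 * n. ?m f j powre (1 / p))"
        using p by (intro mult_left_mono prod_mono_ennreal ennreal_powr_mono nn_integral_mono) (auto simp: fk_def)
      with trunc show "?I (fk k) \<le> 2 * (\<Prod>j=1..2 * n. ?m f j powre (1 / p))"
        by (rule order_trans)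
    qed
    finally show ?thesis .
  qed
  have main: "(\<integral>\<^sup>+ p. (\<Prod>j = 1..2 * n. f j (vert_proj n j p)) \<partial>lebesgue_Rn (2 * n + 1))
      \<le> ennreal 2 * (\<Prod>j = 1..2 * n. Lp_norm p (lebesgue_Rn (2 * n)) (f j))"
    if f: "\<forall>j\<in>{1..2 * n}. f j \<in> borel_measurable (lebesgue_Rn (2 * n))"
    for f :: "nat \<Rightarrow> (nat \<Rightarrow> real) \<Rightarrow> ennreal"
  proof -
    let ?D = "\<lambda>j. {1..2 * n + 1} - {j}"
    \<comment> \<open>Lebesgue measurable functions are replaced by Borel majorants, since
      composition with coordinate maps is controlled for Borel functions.\<close>
    have "\<forall>j\<in>{1..2 * n}. \<exists>g. g \<in> borel_measurable (lborel_PiM {1..2 * n}) \<and>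
        (\<forall>x\<in>space (lborel_PiM {1..2 * n}). f j x \<le> g x) \<and> (AE x in lborel_PiM {1..2 * n}. f j x = g x)"
    proof
      fix j assume "j \<in> {1..2 * n}"
      with f have "f j \<in> borel_measurable (completion (lborel_PiM {1..2 * n}))" by (simp add: lebesgue_Rn_def)
      then show "\<exists>g. g \<in> borel_measurable (lborel_PiM {1..2 * n}) \<and>
        (\<forall>x\<in>space (lborel_PiM {1..2 * n}). f j x \<le> g x) \<and> (AE x in lborel_PiM {1..2 * n}. f j x = g x)"
        by (rule completion_borel_majorant) blast
    qed
    from bchoice[OF this] obtain g where g: "\<And>j. j \<in> {1..2 * n} \<Longrightarrow> g j \<in> borel_measurable (lborel_PiM {1..2 * n})"
      "\<And>j x. j \<in> {1..2 * n} \<Longrightarrow> x \<in> space (lborel_PiM {1..2 * n}) \<Longrightarrow> f j x \<le> g j x"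
      "\<And>j. j \<in> {1..2 * n} \<Longrightarrow> AE x in lborel_PiM {1..2 * n}. f j x = g j x"
      by blast
    \<comment> \<open>The increasing enumeration of the coordinates other than j. Since j \<le> 2n,
      the last index 2n is sent to 2n + 1, the position of t, so renumbering the sheared point gives
      \<open>vert_proj\<close>.\<close>
    define h where "h j i = (if i < j then i else i + 1)" for j i :: nat
    define R where "R j q = (\<lambda>i\<in>{1..2 * n}. q (h j i))" for j and q :: "nat \<Rightarrow> real"
    have bij: "bij_betw (h j) {1..2 * n} (?D j)" if "j \<in> {1..2 * n}" for j
      using that by (intro bij_betw_byWitness[where f' = "\<lambda>i. if i < j then i else i - 1"]) (auto simp: h_def)
    have proj: "vert_proj n j p = R j (shear_proj n j p)" if "j \<in> {1..2 * n}" for j p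
      using that
      by (auto simp: fun_eq_iff vert_proj_def append_coord_def delete_coord_def shear_proj_def R_def h_def)
    have R: "R j \<in> measurable (lborel_PiM (?D j)) (lborel_PiM {1..2 * n})" if "j \<in> {1..2 * n}" for j
      unfolding R_def
    proof (rule measurable_restrict)
      fix i assume "i \<in> {1..2 * n}"
      then have "h j i \<in> ?D j" using bij_betwE[OF bij[OF that]] by blast
      then show "(\<lambda>q. q (h j i)) \<in> measurable (lborel_PiM (?D j)) lborel"
        by (rule measurable_component_singleton)
    qed
    \<comment> \<open>Renumbering preserves the product measure, and the majorant agrees with
      \<open>f j\<close> almost everywhere, so passing to it costs nothing in the norm.\<close>
    have norm: "(\<integral>\<^sup>+q. g j (R j q) powre p \<partial>lborel_PiM (?D j)) powre (1 / p) = Lp_norm p (lebesgue_Rn (2 * n)) (f j)"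
      if j: "j \<in> {1..2 * n}" for j
    proof -
      have "(\<integral>\<^sup>+q. g j (R j q) powre p \<partial>lborel_PiM (?D j))
          = (\<integral>\<^sup>+x. g j x powre p \<partial>distr (lborel_PiM (?D j)) (lborel_PiM {1..2 * n}) (R j))"
        using g(1)[OF j] R[OF j] by (subst nn_integral_distr) auto
      also have "distr (lborel_PiM (?D j)) (lborel_PiM {1..2 * n}) (R j) = lborel_PiM {1..2 * n}"
        unfolding R_def using bij[OF j] by (intro product_sigma_finite.distr_PiM_reindex_bij[OF product_sigma_finite_lborel]) auto
      also have "(\<integral>\<^sup>+x. g j x powre p \<partial>lborel_PiM {1..2 * n}) = (\<integral>\<^sup>+x. f j x powre p \<partial>lborel_PiM {1..2 * n})"
        by (intro nn_integral_cong_AE eventually_mono[OF g(3)[OF j]]) simp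
      finally show ?thesis by (simp add: Lp_norm_def lebesgue_Rn_def nn_integral_completion)
    qed
    have "(\<integral>\<^sup>+p. (\<Prod>j=1..2 * n. f j (vert_proj n j p)) \<partial>lebesgue_Rn (2 * n + 1))
        = (\<integral>\<^sup>+p. (\<Prod>j=1..2 * n. f j (vert_proj n j p)) \<partial>lborel_PiM {1..2 * n + 1})"
      by (simp add: lebesgue_Rn_def nn_integral_completion)
    \<comment> \<open>Here the majorant is used at every point, so no null set has to be pulled back
      along the projections.\<close>
    also have "\<dots> \<le> (\<integral>\<^sup>+p. (\<Prod>j=1..2 * n. g j (R j (shear_proj n j p))) \<partial>lborel_PiM {1..2 * n + 1})"
      by (intro nn_integral_mono prod_mono_ennreal) (simp add: proj g(2) R_def space_PiM)
    also have "\<dots> \<le> 2 * (\<Prod>j=1..2 * n. (\<integral>\<^sup>+q. g j (R j q) powre p \<partial>lborel_PiM (?D j)) powre (1 / p))"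
      by (intro vertical measurable_compose[OF R g(1)])
    also have "\<dots> = ennreal 2 * (\<Prod>j=1..2 * n. Lp_norm p (lebesgue_Rn (2 * n)) (f j))"
    proof -
      have "(\<Prod>j=1..2 * n. (\<integral>\<^sup>+q. g j (R j q) powre p \<partial>lborel_PiM (?D j)) powre (1 / p))
          = (\<Prod>j=1..2 * n. Lp_norm p (lebesgue_Rn (2 * n)) (f j))"
        by (intro prod.cong refl norm)
      then show ?thesis by (simp only: ennreal_numeral)
    qed
    finally show ?thesis .
  qed
  show ?thesis
    unfolding p_def[symmetric] by (intro exI[of _ 2] conjI allI impI main) simp_all
qed

end
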